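(* Let $\mathsf{P}$ be a finite irreducible Markov chain on a state space $V$, $|V|\geq2$, with stationary distribution $\pi$. Let $$\hat\Psi_{min}=\min_{\emptyset\neq A\subset V,\ \pi(A)\leq1/2}\hat\Psi(A),\qquad \Delta_{min}=\min_{\substack{A,B\subset V,\\ \pi(A)\neq\pi(B)}}|\pi(A)-\pi(B)|,$$ $$\hat A_{min}=\min\{\hat\Psi_{min},\Delta_{min}/2\},\qquad \hat A_{max}=\max\{\hat\Psi_{min},\Delta_{min}/2\},$$ $$\mathsf{Q}_{min}=\min_{\emptyset\neq A\subsetneq V}\mathsf{Q}(A,A^c),\qquad \pi_*=\min_{x\in V}\pi(x).$$ Then for every $\epsilon>0$ $$\tau(\epsilon)\ \leq\ \frac{1}{-\log\left(1-2\frac{\hat A_{min}}{\Delta_{min}}\left(1-\cos(2\pi\hat A_{max})\right)\right)}\,\log\frac{1-\pi_*}{\epsilon},$$ every (complex) eigenvalue $\lambda_i\neq1$ of $\mathsf{P}$ satisfies $$1-|\lambda_i|\ \geq\ 2\frac{\hat A_{min}}{\Delta_{min}}\left(1-\cos(2\pi\hat A_{max})\right),$$ and the spectral gap satisfies $$\lambda\ \geq\ \frac{2\mathsf{Q}_{min}}{\pi_*}\left(1-\cos(\pi\,\pi_* )\right).$$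
   Context: For $A\subset V$, $\pi(A)=\sum_{x\in A}\pi(x)$ and $A^c=V\setminus A$. The ergodic flow is $\mathsf{Q}(A,B)=\sum_{x\in A,\,y\in B}\pi(x)\mathsf{P}(x,y)$, with $\mathsf{Q}(A,x)=\mathsf{Q}(A,\{x\})$. Inside cosines, $\pi$ without argument or subscript is the usual constant. For $A\subset V$ put $\hat{\mathsf{Q}}(A,x)=\min\{\mathsf{Q}(A,x),\pi(x)/2\}$ and, for $A\neq\emptyset$, $$\hat\Psi(A)=\min_{\substack{B\subset V,\ v\in V,\\ \pi(B)\leq\pi(A^c)<\pi(B\cup\{v\})}}\ \sum_{x\in B}\hat{\mathsf{Q}}(A,x)+\frac{\pi(A^c)-\pi(B)}{\pi(v)}\,\hat{\mathsf{Q}}(A,v).$$ Spectral gap: with $\mathsf{P}^*(x,y)=\pi(y)\mathsf{P}(y,x)/\pi(x)$, $\lambda$ is the difference between the two largest eigenvalues of $\frac{\mathsf{P}+\mathsf{P}^*}{2}$, i.e. $$\lambda=\inf_{f:\,\mathrm{Var}_\pi(f)\neq0}\frac{\frac12\sum_{x,y}(f(x)-f(y))^2\pi(x)\mathsf{P}(x,y)}{\frac12\sum_{x,y}(f(x)-f(y))^2\pi(x)\pi(y)}.$$ Mixing time: $\tau(\epsilon)$ is the worst-case (over the starting state $x$) number of steps $t$ needed for $\|\mathsf{P}^t(x,\cdot)-\pi\|_{TV}=\frac12\sum_y|\mathsf{P}^t(x,y)-\pi(y)|$ to drop to $\epsilon$. A bound "$\tau(\epsilon)\leq T$" with $T$ real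 means: for every positive integer $t\geq T$ and every $x\in V$, $\|\mathsf{P}^t(x,\cdot)-\pi\|_{TV}\leq\epsilon$. Conventions: $\frac{1}{-\log0}=0$; if $\hat\Psi_{min}=0$ (so that the logarithm is $\log1=0$) the bound on $\tau$ is vacuous. *)

theory Defs
  imports "HOL-Analysis.Analysis"
begin

text \<open>
  The state space is the finite type \<open>'v\<close>; a chain is its transition function \<open>P x y\<close>.
  The variable \<open>\<pi>\<close> is a distribution on states, and \<open>\<pi>(A)\<close> is \<^term>\<open>sum \<pi> A\<close>;
  the circle constant is the library's \<^const>\<open>pi\<close>.
\<close>

definition markov_chain :: "('v::finite \<Rightarrow> 'v \<Rightarrow> real) \<Rightarrow> bool" where
  "markov_chain P \<longleftrightarrow> (\<forall>x y. 0 \<le> P x y) \<and> (\<forall>x. (\<Sum>y\<in>UNIV. P x y) = 1)"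

primrec step_prob :: "('v::finite \<Rightarrow> 'v \<Rightarrow> real) \<Rightarrow> nat \<Rightarrow> 'v \<Rightarrow> 'v \<Rightarrow> real" where
  "step_prob P 0 x y = (if x = y then 1 else 0)"
| "step_prob P (Suc t) x y = (\<Sum>z\<in>UNIV. P x z * step_prob P t z y)"

definition irreducible_chain :: "('v::finite \<Rightarrow> 'v \<Rightarrow> real) \<Rightarrow> bool" where
  "irreducible_chain P \<longleftrightarrow> (\<forall>x y. \<exists>t. 0 < step_prob P t x y)"

definition stationary_distribution :: "('v::finite \<Rightarrow> 'v \<Rightarrow> real) \<Rightarrow> ('v \<Rightarrow> real) \<Rightarrow> bool" where
  "stationary_distribution P \<pi> \<longleftrightarrow>
     (\<forall>x. 0 \<le> \<pi> x) \<and> (\<Sum>x\<in>UNIV. \<pi> x) = 1 \<and> (\<forall>y. (\<Sum>x\<in>UNIV. \<pi> x * P x y) = \<pi> y)"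

definition ergodic_flow ::
  "('v::finite \<Rightarrow> 'v \<Rightarrow> real) \<Rightarrow> ('v \<Rightarrow> real) \<Rightarrow> 'v set \<Rightarrow> 'v set \<Rightarrow> real" where
  "ergodic_flow P \<pi> A B = (\<Sum>x\<in>A. \<Sum>y\<in>B. \<pi> x * P x y)"

definition Q_hat :: "('v::finite \<Rightarrow> 'v \<Rightarrow> real) \<Rightarrow> ('v \<Rightarrow> real) \<Rightarrow> 'v set \<Rightarrow> 'v \<Rightarrow> real" where
  "Q_hat P \<pi> A x = min (ergodic_flow P \<pi> A {x}) (\<pi> x / 2)"

text \<open>
  The minima below are taken over finite sets. They are nonempty when \<open>\<pi>\<close> is a positive
  distribution, \<open>'v\<close> has at least two elements and, for \<open>Psi_hat\<close>, \<open>A \<noteq> {}\<close>.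
\<close>

definition Psi_hat :: "('v::finite \<Rightarrow> 'v \<Rightarrow> real) \<Rightarrow> ('v \<Rightarrow> real) \<Rightarrow> 'v set \<Rightarrow> real" where
  "Psi_hat P \<pi> A =
     Min {(\<Sum>x\<in>B. Q_hat P \<pi> A x) + (sum \<pi> (- A) - sum \<pi> B) / \<pi> v * Q_hat P \<pi> A v | B v.
            sum \<pi> B \<le> sum \<pi> (- A) \<and> sum \<pi> (- A) < sum \<pi> (B \<union> {v})}"

definition Psi_hat_min :: "('v::finite \<Rightarrow> 'v \<Rightarrow> real) \<Rightarrow> ('v \<Rightarrow> real) \<Rightarrow> real" where
  "Psi_hat_min P \<pi> = Min {Psi_hat P \<pi> A | A. A \<noteq> {} \<and> sum \<pi> A \<le> 1 / 2}"

definition Delta_min :: "('v::finite \<Rightarrow> real) \<Rightarrow> real" where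
  "Delta_min \<pi> = Min {\<bar>sum \<pi> A - sum \<pi> B\<bar> | A B. sum \<pi> A \<noteq> sum \<pi> B}"

definition A_hat_min :: "('v::finite \<Rightarrow> 'v \<Rightarrow> real) \<Rightarrow> ('v \<Rightarrow> real) \<Rightarrow> real" where
  "A_hat_min P \<pi> = min (Psi_hat_min P \<pi>) (Delta_min \<pi> / 2)"

definition A_hat_max :: "('v::finite \<Rightarrow> 'v \<Rightarrow> real) \<Rightarrow> ('v \<Rightarrow> real) \<Rightarrow> real" where
  "A_hat_max P \<pi> = max (Psi_hat_min P \<pi>) (Delta_min \<pi> / 2)"

definition Q_min :: "('v::finite \<Rightarrow> 'v \<Rightarrow> real) \<Rightarrow> ('v \<Rightarrow> real) \<Rightarrow> real" where
  "Q_min P \<pi> = Min {ergodic_flow P \<pi> A (- A) | A. A \<noteq> {} \<and> A \<noteq> UNIV}"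

definition pi_min :: "('v::finite \<Rightarrow> real) \<Rightarrow> real" where
  "pi_min \<pi> = Min (range \<pi>)"

definition tv_dist :: "('v::finite \<Rightarrow> real) \<Rightarrow> ('v \<Rightarrow> real) \<Rightarrow> real" where
  "tv_dist \<mu> \<nu> = (\<Sum>y\<in>UNIV. \<bar>\<mu> y - \<nu> y\<bar>) / 2"

text \<open>
  The bound \<open>\<tau>(\<epsilon>) \<le> T\<close> for a real, possibly nonpositive \<open>T\<close>: it speaks about
  positive times only.
\<close>

definition mixing_time_le ::
  "('v::finite \<Rightarrow> 'v \<Rightarrow> real) \<Rightarrow> ('v \<Rightarrow> real) \<Rightarrow> real \<Rightarrow> real \<Rightarrow> bool" where
  "mixing_time_le P \<pi> \<epsilon> T \<longleftrightarrow>
     (\<forall>t::nat. 0 < t \<and> T \<le> real t \<longrightarrow> (\<forall>x. tv_dist (step_prob P t x) \<pi> \<le> \<epsilon>))"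

text \<open>\<open>1 / (- log z)\<close> with the convention \<open>1 / (- log 0) = 0\<close>.\<close>

definition inverse_neg_ln :: "real \<Rightarrow> real" where
  "inverse_neg_ln z = (if z = 0 then 0 else 1 / (- ln z))"

definition chain_eigenvalue :: "('v::finite \<Rightarrow> 'v \<Rightarrow> real) \<Rightarrow> complex \<Rightarrow> bool" where
  "chain_eigenvalue P l \<longleftrightarrow>
     (\<exists>f::'v \<Rightarrow> complex. (\<exists>x. f x \<noteq> 0) \<and> (\<forall>x. (\<Sum>y\<in>UNIV. of_real (P x y) * f y) = l * f x))"

definition expect :: "('v::finite \<Rightarrow> real) \<Rightarrow> ('v \<Rightarrow> real) \<Rightarrow> real" where
  "expect \<pi> f = (\<Sum>x\<in>UNIV. \<pi> x * f x)"

definition var :: "('v::finite \<Rightarrow> real) \<Rightarrow> ('v \<Rightarrow> real) \<Rightarrow> real" where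
  "var \<pi> f = expect \<pi> (\<lambda>x. (f x - expect \<pi> f)\<^sup>2)"

text \<open>
  The spectral gap of the additive reversibilization \<open>(P + P*) / 2\<close>, given by its
  variational formula.
\<close>

definition spectral_gap :: "('v::finite \<Rightarrow> 'v \<Rightarrow> real) \<Rightarrow> ('v \<Rightarrow> real) \<Rightarrow> real" where
  "spectral_gap P \<pi> =
     Inf {(1 / 2 * (\<Sum>x\<in>UNIV. \<Sum>y\<in>UNIV. (f x - f y)\<^sup>2 * \<pi> x * P x y)) /
          (1 / 2 * (\<Sum>x\<in>UNIV. \<Sum>y\<in>UNIV. (f x - f y)\<^sup>2 * \<pi> x * \<pi> y)) | f. var \<pi> f \<noteq> 0}"

end

theory Submission
  imports Defs
begin

text \<open>
  The proof uses evolving sets. Given a set \<open>A\<close> of states and a level \<open>u\<close> drawn uniformly from the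
  unit interval, let \<open>A\<^sub>u\<close> be the set of those \<open>y\<close> that receive from \<open>A\<close> in one step more than the
  fraction \<open>u\<close> of their mass \<open>\<pi> y\<close>. For every weight \<open>h\<close>, the mean over \<open>u\<close> of
  \<open>\<Sum>y\<in>A\<^sub>u. \<pi> y * h y\<close> is \<open>\<Sum>y. Q(A,y) * h y\<close>: averaging over levels performs one step of the chain
  (\<open>flow_step_evol\<close>), and in particular \<open>\<pi>(A\<^sub>u)\<close> has mean \<open>\<pi>(A)\<close>.

  Measure the distance from equilibrium of the chain started from \<open>\<pi>\<close> restricted to \<open>A\<close> by
  \<open>D\<^sub>t(A) = 1/2 * \<Sum>y. \<bar>(\<Sum>x\<in>A. \<pi> x * P\<^sup>t(x,y)) - \<pi>(A) * \<pi> y\<bar>\<close>. The triangle inequality gives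
  \<open>D\<^sub>t\<^sub>+\<^sub>1(A) \<le> \<integral> D\<^sub>t(A\<^sub>u) du\<close>, while \<open>D\<^sub>0(A) = \<pi>(A) * (1 - \<pi>(A))\<close> and \<open>D\<^sub>t\<close> does not change when \<open>A\<close> is
  replaced by its complement. Hence, if the mean of \<open>sin (pi * \<pi>(A\<^sub>u))\<close> is at most \<open>C * sin (pi * \<pi>(A))\<close> for
  all sets of mass at most one half, then \<open>D\<^sub>t(A)\<close> is at most \<open>C\<^sup>t\<close> times a multiple of
  \<open>sin (pi * \<pi>(A))\<close> (\<open>set_deviation_decay\<close>). Nontrivial sets have mass between \<open>\<pi>\<^sub>*\<close> and \<open>1 - \<pi>\<^sub>*\<close>, and
  \<open>x * (1 - x) / sin (pi * x)\<close> and \<open>sin (pi * x) / x\<close> decrease on the relevant ranges. For singletons this yields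
  the total variation bound \<open>(1 - \<pi>\<^sub>*) * C\<^sup>t\<close> with the exact constant (\<open>tv_decay\<close>). The mixing time and
  eigenvalue bounds follow, the latter because an eigenfunction for \<open>l \<noteq> 1\<close> has mean zero, so that
  \<open>\<bar>l\<bar>\<^sup>t\<close> is at most a constant times \<open>C\<^sup>t\<close> for all \<open>t\<close>.

  The contraction itself is a statement about the random variable \<open>X = \<pi>(A\<^sub>u)\<close> with mean \<open>a = \<pi>(A)\<close>. Since the
  sine is concave, spreading \<open>X\<close> lowers its mean sine. A greedy choice of \<open>B\<close> and \<open>v\<close> shows that \<open>\<Psi>(A)\<close>, short
  for \<open>Psi_hat P \<pi> A\<close>, is at most the integral of the positive part of \<open>X - a\<close> over levels \<open>u\<close>
  below one half. If \<open>\<Psi>\<^sub>m\<^sub>i\<^sub>n \<le> \<Delta>\<^sub>m\<^sub>i\<^sub>n / 2\<close>, what is used is that \<open>X\<close> leaves \<open>a\<close> only by jumps of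
  size at least \<open>\<Delta>\<^sub>m\<^sub>i\<^sub>n\<close> (\<open>integral_sin_spread_chord\<close>); otherwise \<open>X\<close> is compared with the variable
  that takes the values \<open>a \<plusminus> 2 * \<Psi>\<^sub>m\<^sub>i\<^sub>n\<close> with equal probability (\<open>integral_sin_spread_half\<close>).

  For the spectral gap, the argument is applied to \<open>I/2 + (P + P\<^sup>*)/4\<close>. At levels below one half the evolving set of this
  chain contains \<open>A\<close>, at the others it is contained in \<open>A\<close>; so the mass stays or jumps by at least \<open>\<pi>\<^sub>*\<close>, and the expected
  positive part is at least \<open>Q\<^sub>m\<^sub>i\<^sub>n / 2\<close>. Reversibility makes the squared norms of the iterates of a mean zero
  function log-convex in time, so that the exponential decay at infinity already controls the first step
  (\<open>reversible_form_le\<close>); the bound on the first step is a bound on the Dirichlet form.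
\<close>

section \<open>The sine function on the unit interval\<close>

lemma sin_pi_le_tangent:
  fixes x y :: real
  assumes "0 \<le> x" "x \<le> 1" "0 \<le> y" "y \<le> 1"
  shows "sin (pi * x) \<le> sin (pi * y) + pi * cos (pi * y) * (x - y)"
proof -
  have *: "sin v \<le> sin u + cos u * (v - u)"
    if uv: "0 \<le> u" "u \<le> pi" "0 \<le> v" "v \<le> pi" for u v :: real
  proof (cases u v rule: linorder_cases)
    case less
    then obtain z where z: "u < z" "z < v" "sin v - sin u = (v - u) * cos z"
      using MVT2[of u v sin cos] DERIV_sin by blast
    have "cos z \<le> cos u" using z uv by (intro cos_monotone_0_pi_le) auto
    then have "(v - u) * cos z \<le> (v - u) * cos u" using less by (intro mult_left_mono) auto
    then show ?thesis using z by (simp add: algebra_simps)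
  next
    case greater
    then obtain z where z: "v < z" "z < u" "sin u - sin v = (u - v) * cos z"
      using MVT2[of v u sin cos] DERIV_sin by blast
    have "cos u \<le> cos z" using z uv by (intro cos_monotone_0_pi_le) auto
    then have "(u - v) * cos u \<le> (u - v) * cos z" using greater by (intro mult_left_mono) auto
    then show ?thesis using z by (simp add: algebra_simps)
  qed auto
  have "sin (pi * x) \<le> sin (pi * y) + cos (pi * y) * (pi * x - pi * y)"
    using assms by (intro *) auto
  then show ?thesis by (simp add: algebra_simps)
qed

lemma sin_pi_nonneg: "0 \<le> x \<Longrightarrow> x \<le> 1 \<Longrightarrow> 0 \<le> sin (pi * x)" for x :: real
  by (intro sin_ge_zero) auto

lemma sin_pi_pos: "0 < x \<Longrightarrow> x < 1 \<Longrightarrow> 0 < sin (pi * x)" for x :: real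
  by (intro sin_gt_zero) auto

lemma sin_pi_one_minus: "sin (pi * (1 - x)) = sin (pi * x)" for x :: real
  by (simp add: right_diff_distrib sin_diff)

lemma sin_pi_over_id_antimono:
  fixes b c :: real
  assumes "0 < b" "b \<le> c" "c \<le> 1"
  shows "sin (pi * c) / c \<le> sin (pi * b) / b"
proof -
  define s where "s = pi * cos (pi * b)"
  have s: "s * b \<le> sin (pi * b)"
    using sin_pi_le_tangent[of 0 b] assms by (simp add: s_def)
  have "sin (pi * c) \<le> sin (pi * b) + s * (c - b)"
    using sin_pi_le_tangent[of c b] assms by (simp add: s_def)
  then have "b * sin (pi * c) \<le> b * (sin (pi * b) + s * (c - b))"
    using assms by (intro mult_left_mono) auto
  also have "\<dots> = b * sin (pi * b) + (s * b) * (c - b)" by (simp add: algebra_simps)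
  also have "\<dots> \<le> b * sin (pi * b) + sin (pi * b) * (c - b)"
    using s assms by (simp add: mult_right_mono)
  finally have "b * sin (pi * c) \<le> c * sin (pi * b)" by (simp add: algebra_simps)
  then show ?thesis using assms by (simp add: field_simps)
qed

text \<open>
  Up to sign, this is the numerator of the derivative of \<open>x * (1 - x) / sin (pi * x)\<close>. It vanishes at \<open>0\<close> and at \<open>1/2\<close>, and
  its own derivative is \<open>sin (pi * x) * (2 - pi\<^sup>2 * x * (1 - x))\<close>, which changes sign only once, from positive
  to negative.
\<close>

lemma parabola_sin_slope_nonneg:
  fixes x :: real
  assumes "0 \<le> x" "x \<le> 1/2"
  shows "0 \<le> pi * x * (1 - x) * cos (pi * x) - (1 - 2 * x) * sin (pi * x)"
proof -
  define k where "k x = pi * x * (1 - x) * cos (pi * x) - (1 - 2 * x) * sin (pi * x)" for x :: real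
  have d: "(k has_real_derivative sin (pi * x) * (2 - pi\<^sup>2 * (x * (1 - x)))) (at x)" for x
    unfolding k_def by (auto intro!: derivative_eq_intros simp: algebra_simps power2_eq_square)
  have mono: "y * (1 - y) \<le> z * (1 - z)" if "y \<le> z" "z \<le> 1/2" for y z :: real
  proof -
    have "0 \<le> (z - y) * (1 - z - y)" using that by (intro mult_nonneg_nonneg) auto
    then show ?thesis by (simp add: algebra_simps)
  qed
  have s: "0 \<le> sin (pi * z)" if "0 \<le> z" "z \<le> 1/2" for z using that by (intro sin_pi_nonneg) auto
  show ?thesis
  proof (cases "pi\<^sup>2 * (x * (1 - x)) \<le> 2")
    case True
    have "k 0 \<le> k x"
    proof (rule DERIV_nonneg_imp_nondecreasing[OF assms(1)])
      fix z assume z: "0 \<le> z" "z \<le> x"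
      have "pi\<^sup>2 * (z * (1 - z)) \<le> pi\<^sup>2 * (x * (1 - x))"
        using z assms by (intro mult_left_mono[OF mono]) auto
      then have "0 \<le> sin (pi * z) * (2 - pi\<^sup>2 * (z * (1 - z)))"
        using True s[of z] z assms by (intro mult_nonneg_nonneg) linarith+
      then show "\<exists>y. (k has_real_derivative y) (at z) \<and> 0 \<le> y" using d by blast
    qed
    then show ?thesis by (simp add: k_def)
  next
    case False
    have "k (1/2) \<le> k x"
    proof (rule DERIV_nonpos_imp_nonincreasing[OF assms(2)])
      fix z :: real assume z: "x \<le> z" "z \<le> 1/2"
      have "pi\<^sup>2 * (x * (1 - x)) \<le> pi\<^sup>2 * (z * (1 - z))"
        using z assms by (intro mult_left_mono[OF mono]) auto
      then have "sin (pi * z) * (2 - pi\<^sup>2 * (z * (1 - z))) \<le> 0"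
        using False s[of z] z assms by (intro mult_nonneg_nonpos) linarith+
      then show "\<exists>y. (k has_real_derivative y) (at z) \<and> y \<le> 0" using d by blast
    qed
    then show ?thesis by (simp add: k_def)
  qed
qed

lemma parabola_over_sin_pi_antimono:
  fixes a b :: real
  assumes b: "0 < b" "b \<le> a" and a: "a \<le> 1/2"
  shows "a * (1 - a) / sin (pi * a) \<le> b * (1 - b) / sin (pi * b)"
proof (rule DERIV_nonpos_imp_nonincreasing[OF b(2)])
  fix z :: real assume z: "b \<le> z" "z \<le> a"
  have s: "0 < sin (pi * z)" using assms z by (intro sin_pi_pos) auto
  let ?y = "((1 - 2 * z) * sin (pi * z) - z * (1 - z) * (pi * cos (pi * z))) / (sin (pi * z))\<^sup>2"
  have "((\<lambda>x. x * (1 - x) / sin (pi * x)) has_real_derivative ?y) (at z)"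
    using s by (auto intro!: derivative_eq_intros simp: algebra_simps power2_eq_square)
  moreover have "?y \<le> 0"
    using parabola_sin_slope_nonneg[of z] z assms by (intro divide_nonpos_nonneg) (auto simp: algebra_simps)
  ultimately show "\<exists>y. ((\<lambda>x. x * (1 - x) / sin (pi * x)) has_real_derivative y) (at z) \<and> y \<le> 0" by blast
qed

text \<open>
  Among sets of states that are neither empty nor full, the ratio of \<open>a * (1 - a)\<close> to \<open>sin (pi * a)\<close> is largest at the least
  possible mass \<open>b\<close>; this keeps the sharp factor \<open>1 - \<pi>\<^sub>*\<close> in the mixing time.
\<close>

lemma parabola_le_sin_pi:
  fixes a b :: real
  assumes "0 < b" "b \<le> a" "a \<le> 1 - b"
  shows "a * (1 - a) \<le> b * (1 - b) / sin (pi * b) * sin (pi * a)"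
proof -
  have *: "c * (1 - c) \<le> b * (1 - b) / sin (pi * b) * sin (pi * c)" if "b \<le> c" "c \<le> 1/2" for c
  proof -
    have "0 < sin (pi * c)" using assms that by (intro sin_pi_pos) auto
    then show ?thesis using parabola_over_sin_pi_antimono[OF assms(1) that] by (simp add: pos_divide_le_eq)
  qed
  show ?thesis
  proof (cases "a \<le> 1/2")
    case True then show ?thesis using * assms by auto
  next
    case False
    then show ?thesis using *[of "1 - a"] assms by (simp only: sin_pi_one_minus) (simp add: mult.commute)
  qed
qed

section \<open>The mean sine of a spread-out variable\<close>

text \<open>
  As \<open>X\<close> avoids the open intervals between \<open>a - d\<close>, \<open>a\<close> and \<open>a + d\<close>, concavity puts the sine at \<open>X\<close> below the chord through \<open>a\<close>
  and \<open>a + d\<close> on the right of \<open>a\<close>, and below the chord through \<open>a - d\<close> and \<open>a\<close> on the left. The difference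
  of the slopes of these chords is the second difference of the sine, which is where \<open>1 - cos (pi * d)\<close> comes from.
\<close>

lemma integral_sin_spread_chord:
  fixes X :: "real \<Rightarrow> real"
  assumes range: "\<And>u. 0 \<le> X u \<and> X u \<le> 1"
    and jump: "\<And>u. X u = a \<or> d \<le> \<bar>X u - a\<bar>"
    and d: "0 < d" "d \<le> a" "d \<le> 1 - a"
    and int_sin: "(\<lambda>u. sin (pi * X u)) integrable_on {0..1}"
    and int_X: "X integrable_on {0..1}"
    and int_plus: "(\<lambda>u. max 0 (X u - a)) integrable_on {0..1}"
    and mean: "integral {0..1} X = a"
    and spread: "\<psi> \<le> integral {0..1} (\<lambda>u. max 0 (X u - a))"
  shows "integral {0..1} (\<lambda>u. sin (pi * X u)) \<le> (1 - 2 * \<psi> / d * (1 - cos (pi * d))) * sin (pi * a)"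
proof -
  define f where "f x = sin (pi * x)" for x :: real
  \<comment> \<open>the slopes of the chords to the right and to the left of \<open>a\<close>\<close>
  define s where "s = (f (a + d) - f a) / d"
  define r where "r = (f a - f (a - d)) / d"
  have sa: "0 \<le> sin (pi * a)" using d by (intro sin_pi_nonneg) auto
  have sr: "(s - r) = - 2 / d * (1 - cos (pi * d)) * sin (pi * a)"
    unfolding s_def r_def f_def using d
    by (simp add: field_simps distrib_left right_diff_distrib sin_add sin_diff)
  \<comment> \<open>one inequality for both sides: the negative part of \<open>X u - a\<close> is its positive part minus \<open>X u - a\<close>\<close>
  have pointwise: "f (X u) \<le> f a + r * (X u - a) + (s - r) * max 0 (X u - a)" for u
  proof -
    consider "X u = a" | "a + d \<le> X u" | "X u \<le> a - d" using jump[of u] d by force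
    then show ?thesis
    proof cases
      case 2
      define \<sigma> where "\<sigma> = pi * cos (pi * (a + d))"
      have "f a \<le> f (a + d) + \<sigma> * (a - (a + d))"
        unfolding f_def \<sigma>_def using d by (intro sin_pi_le_tangent) auto
      then have "\<sigma> \<le> s" using d by (simp add: s_def field_simps)
      then have "\<sigma> * (X u - (a + d)) \<le> s * (X u - (a + d))" using 2 by (intro mult_right_mono) auto
      moreover have "f (X u) \<le> f (a + d) + \<sigma> * (X u - (a + d))"
        unfolding f_def \<sigma>_def using d 2 range[of u] by (intro sin_pi_le_tangent) auto
      moreover have "f (a + d) = f a + s * d" using d by (simp add: s_def)
      ultimately have "f (X u) \<le> f a + s * (X u - a)" by (simp add: algebra_simps)
      then show ?thesis using 2 d by (simp add: max_def algebra_simps)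
    next
      case 3
      define \<sigma> where "\<sigma> = pi * cos (pi * (a - d))"
      have "f a \<le> f (a - d) + \<sigma> * (a - (a - d))"
        unfolding f_def \<sigma>_def using d by (intro sin_pi_le_tangent) auto
      then have "r \<le> \<sigma>" using d by (simp add: r_def field_simps)
      then have "\<sigma> * (X u - (a - d)) \<le> r * (X u - (a - d))" using 3 by (intro mult_right_mono_neg) auto
      moreover have "f (X u) \<le> f (a - d) + \<sigma> * (X u - (a - d))"
        unfolding f_def \<sigma>_def using d 3 range[of u] by (intro sin_pi_le_tangent) auto
      moreover have "f (a - d) = f a - r * d" using d by (simp add: r_def)
      ultimately have "f (X u) \<le> f a + r * (X u - a)" by (simp add: algebra_simps)
      then show ?thesis using 3 d by (simp add: max_def)
    qed auto
  qed
  have "((\<lambda>u. f a + r * (X u - a) + (s - r) * max 0 (X u - a)) has_integral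
      f a * (1 - 0) + r * (a - a * (1 - 0)) + (s - r) * integral {0..1} (\<lambda>u. max 0 (X u - a))) {0..1}"
    using has_integral_const_real[of "f a" 0 1] has_integral_const_real[of "a" 0 1]
      integrable_integral[OF int_X] integrable_integral[OF int_plus] mean
    by (intro has_integral_add has_integral_mult_right has_integral_diff) (auto simp: mult.commute)
  from has_integral_le[OF integrable_integral[OF int_sin] this]
  have "integral {0..1} (\<lambda>u. sin (pi * X u)) \<le> f a + (s - r) * integral {0..1} (\<lambda>u. max 0 (X u - a))"
    using pointwise by (simp add: f_def)
  also have "\<dots> \<le> f a + (s - r) * \<psi>"
    using spread sr sa d by (intro add_left_mono mult_left_mono_neg) (auto simp: mult_nonpos_nonneg divide_nonpos_pos)
  also have "\<dots> = (1 - 2 * \<psi> / d * (1 - cos (pi * d))) * sin (pi * a)"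
    unfolding sr f_def by (simp add: divide_inverse) algebra
  finally show ?thesis .
qed

text \<open>
  The extremal variable takes the values \<open>a + d\<close> for \<open>u < 1/2\<close> and \<open>a - d\<close> for \<open>u > 1/2\<close>, where \<open>d = 2 * \<psi>\<close>. The sine is
  therefore bounded by tangents at these two points. Write \<open>R\<close> and \<open>L\<close> for the heights of the two tangents
  over \<open>a\<close>. Since \<open>a \<le> 1/2\<close>, the sine takes larger values, and so is more strongly curved,
  on the right of \<open>a\<close> than on the left, and \<open>L \<le> R\<close>. So for \<open>u < 1/2\<close> the broken line of
  height \<open>R\<close> at \<open>a\<close> lies above the sine, even where \<open>X u < a\<close>, and for \<open>u > 1/2\<close> the left tangent does. Adding up, only
  the integral of the positive part over \<open>u < 1/2\<close> enters, with the nonpositive coefficient \<open>\<sigma> (a + d) - \<sigma> (a - r)\<close>.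
\<close>

lemma integral_sin_spread_half:
  fixes X :: "real \<Rightarrow> real"
  assumes range: "\<And>u. 0 \<le> X u \<and> X u \<le> 1"
    and a: "0 \<le> a" "a \<le> 1/2" and \<psi>: "0 \<le> \<psi>"
    and int_sin: "(\<lambda>u. sin (pi * X u)) integrable_on {0..1}"
    and int_X: "X integrable_on {0..1}"
    and int_plus: "(\<lambda>u. max 0 (X u - a)) integrable_on {0..1/2}"
    and mean: "integral {0..1} X = a"
    and spread: "\<psi> \<le> integral {0..1/2} (\<lambda>u. max 0 (X u - a))"
  shows "integral {0..1} (\<lambda>u. sin (pi * X u)) \<le> cos (2 * pi * \<psi>) * sin (pi * a)"
proof -
  define f where "f x = sin (pi * x)" for x :: real
  define \<sigma> where "\<sigma> x = pi * cos (pi * x)" for x :: real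
  define d where "d = 2 * \<psi>"
  \<comment> \<open>\<open>a - d\<close> may be negative, where a tangent to the sine no longer bounds it on the unit interval; then the tangent at \<open>0\<close> is used\<close>
  define r where "r = min d a"
  define I where "I = integral {0..1/2} (\<lambda>u. max 0 (X u - a))"
  have "I \<le> integral {0..1/2::real} (\<lambda>u. 1 - a)"
    unfolding I_def using int_plus a by (intro integral_le) (auto simp: range max_def)
  then have d: "0 \<le> d" "a + d \<le> 1" using spread \<psi> by (auto simp: d_def I_def field_simps)
  have r: "0 \<le> r" "r \<le> d" "r \<le> a" using d a by (auto simp: r_def)
  have tangent: "f x \<le> f y + \<sigma> y * (x - y)" if "0 \<le> x" "x \<le> 1" "0 \<le> y" "y \<le> 1" for x y
    unfolding f_def \<sigma>_def using that by (rule sin_pi_le_tangent)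
  have slope: "\<sigma> y \<le> \<sigma> x" if "0 \<le> x" "x \<le> y" "y \<le> 1" for x y
    unfolding \<sigma>_def using that by (intro mult_left_mono cos_monotone_0_pi_le) auto
  define R where "R = f (a + d) - \<sigma> (a + d) * d"
  define L where "L = f (a - r) + \<sigma> (a - r) * r"
  \<comment> \<open>first against the tangent at \<open>a + r\<close>, whose height over \<open>a\<close> only grows as its point of contact moves right to \<open>a + d\<close>\<close>
  have LR: "L \<le> R"
  proof -
    have "0 \<le> sin (pi * r) - pi * r * cos (pi * r)"
      using sin_pi_le_tangent[of 0 r] r d a by (simp add: algebra_simps)
    moreover have "0 \<le> cos (pi * a)" using a by (intro cos_ge_zero) (auto simp: field_simps intro: order.trans[of _ 0])
    ultimately have "0 \<le> 2 * cos (pi * a) * (sin (pi * r) - pi * r * cos (pi * r))" by simp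
    also have "\<dots> = (f (a + r) - \<sigma> (a + r) * r) - L"
      unfolding f_def \<sigma>_def L_def by (simp add: distrib_left right_diff_distrib sin_add sin_diff cos_add cos_diff algebra_simps)
    finally have "L \<le> f (a + r) - \<sigma> (a + r) * r" by simp
    also have "\<dots> \<le> f (a + r) - \<sigma> (a + d) * r"
      using slope[of "a + r" "a + d"] r d a by (simp add: mult_right_mono)
    also have "\<dots> \<le> R"
      using tangent[of "a + r" "a + d"] r d a unfolding R_def by (simp add: algebra_simps)
    finally show ?thesis .
  qed
  \<comment> \<open>below \<open>0\<close> the sine lies above its tangent at \<open>0\<close>\<close>
  have left: "L - \<sigma> (a - r) * d \<le> f (a - d)"
  proof (cases "d \<le> a")
    case True
    then show ?thesis by (simp add: L_def r_def)
  next
    case False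
    then have "L - \<sigma> (a - r) * d = - (pi * (d - a))" by (simp add: L_def r_def \<sigma>_def f_def algebra_simps)
    also have "\<dots> \<le> - sin (pi * (d - a))" using False by (simp add: sin_x_le_x)
    also have "\<dots> = f (a - d)" unfolding f_def by (simp only: right_diff_distrib sin_diff) simp
    finally show ?thesis .
  qed
  have low: "f (X u) \<le> R + \<sigma> (a - r) * (X u - a) + (\<sigma> (a + d) - \<sigma> (a - r)) * max 0 (X u - a)" for u
  proof (cases "a \<le> X u")
    case True
    then show ?thesis using tangent[of "X u" "a + d"] range[of u] d a
      by (simp add: R_def max_def algebra_simps)
  next
    case False
    then show ?thesis using tangent[of "X u" "a - r"] range[of u] r a LR
      by (simp add: L_def max_def algebra_simps)
  qed
  have high: "f (X u) \<le> L + \<sigma> (a - r) * (X u - a)" for u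
    using tangent[of "X u" "a - r"] range[of u] r a by (simp add: L_def algebra_simps)
  have subint: "g integrable_on {0..1/2}" "g integrable_on {1/2..1}"
    if "g integrable_on {0..1}" for g :: "real \<Rightarrow> real"
    using that by (auto intro: integrable_on_subinterval)
  have split: "integral {0..1} g = integral {0..1/2} g + integral {1/2..1} g"
    if "g integrable_on {0..1}" for g :: "real \<Rightarrow> real"
    using Henstock_Kurzweil_Integration.integral_combine[of 0 "1/2" 1 g] that by simp
  have "((\<lambda>u. R + \<sigma> (a - r) * (X u - a) + (\<sigma> (a + d) - \<sigma> (a - r)) * max 0 (X u - a)) has_integral
      R * (1/2 - 0) + \<sigma> (a - r) * (integral {0..1/2} X - a * (1/2 - 0)) + (\<sigma> (a + d) - \<sigma> (a - r)) * I) {0..1/2}"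
    using has_integral_const_real[of R 0 "1/2"] has_integral_const_real[of a 0 "1/2"]
      integrable_integral[OF subint(1)[OF int_X]] integrable_integral[OF int_plus]
    unfolding I_def
    by (intro has_integral_add has_integral_mult_right has_integral_diff) (auto simp: mult.commute)
  from has_integral_le[OF integrable_integral[OF subint(1)[OF int_sin]] this]
  have 1: "integral {0..1/2} (\<lambda>u. f (X u)) \<le>
      R / 2 + \<sigma> (a - r) * (integral {0..1/2} X - a / 2) + (\<sigma> (a + d) - \<sigma> (a - r)) * I"
    using low by (simp add: f_def)
  have "((\<lambda>u. L + \<sigma> (a - r) * (X u - a)) has_integral
      L * (1 - 1/2) + \<sigma> (a - r) * (integral {1/2..1} X - a * (1 - 1/2))) {1/2..1}"
    using has_integral_const_real[of L "1/2" 1] has_integral_const_real[of a "1/2" 1]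
      integrable_integral[OF subint(2)[OF int_X]]
    by (intro has_integral_add has_integral_mult_right has_integral_diff) (auto simp: mult.commute)
  from has_integral_le[OF integrable_integral[OF subint(2)[OF int_sin]] this]
  have 2: "integral {1/2..1} (\<lambda>u. f (X u)) \<le> L / 2 + \<sigma> (a - r) * (integral {1/2..1} X - a / 2)"
    using high by (simp add: f_def)
  have "integral {0..1} (\<lambda>u. f (X u)) \<le>
      R / 2 + L / 2 + (\<sigma> (a + d) - \<sigma> (a - r)) * I + \<sigma> (a - r) * (integral {0..1} X - a)"
    using 1 2 split[OF int_sin] split[OF int_X] unfolding f_def by (simp add: algebra_simps)
  also have "\<dots> \<le> R / 2 + L / 2 + (\<sigma> (a + d) - \<sigma> (a - r)) * \<psi>"
    using mean spread slope[of "a - r" "a + d"] r d a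
    by (simp add: I_def mult_left_mono_neg)
  also have "\<dots> = (f (a + d) + (L - \<sigma> (a - r) * d)) / 2"
    by (simp add: R_def d_def field_simps)
  also have "\<dots> \<le> (f (a + d) + f (a - d)) / 2" using left by simp
  also have "\<dots> = cos (2 * pi * \<psi>) * sin (pi * a)"
    unfolding f_def d_def by (simp add: distrib_left right_diff_distrib sin_add sin_diff algebra_simps)
  finally show ?thesis by (simp add: f_def)
qed

section \<open>Stationary chains and evolving sets\<close>

lemma stationary_step_prob:
  assumes "stationary_distribution P \<pi>"
  shows "(\<Sum>x\<in>UNIV. \<pi> x * step_prob P t x y) = \<pi> y"
proof (induction t)
  case 0
  then show ?case by (simp add: if_distrib cong: if_cong)
next
  case (Suc t)
  have "(\<Sum>x\<in>UNIV. \<pi> x * step_prob P (Suc t) x y) =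
      (\<Sum>x\<in>UNIV. \<Sum>z\<in>UNIV. \<pi> x * P x z * step_prob P t z y)"
    by (simp add: sum_distrib_left mult.assoc)
  also have "\<dots> = (\<Sum>z\<in>UNIV. (\<Sum>x\<in>UNIV. \<pi> x * P x z) * step_prob P t z y)"
    by (subst sum.swap) (simp add: sum_distrib_right)
  finally show ?case using Suc assms by (simp add: stationary_distribution_def)
qed

text \<open>
  A constant factor in an exponential bound cannot change the exponential rate.
\<close>

lemma le_of_powers_dominated:
  fixes r C K :: real
  assumes dom: "\<And>t. r ^ t \<le> K * C ^ t" and C: "0 \<le> C"
  shows "r \<le> C"
proof (rule ccontr)
  assume "\<not> r \<le> C"
  then have r: "0 < r" "C < r" using C by auto
  have "(\<lambda>t. K * (C / r) ^ t) \<longlonglongrightarrow> K * 0"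
    using r C by (intro tendsto_mult_left LIMSEQ_realpow_zero) auto
  then have "eventually (\<lambda>t. K * (C / r) ^ t < 1) sequentially"
    by (intro order_tendstoD(2)[of _ "K * 0"]) auto
  then obtain t where "K * (C / r) ^ t < 1" by (auto simp: eventually_sequentially)
  then show False using dom[of t] r by (simp add: power_divide field_simps)
qed

lemma step_prob_nonneg: "markov_chain P \<Longrightarrow> 0 \<le> step_prob P t x y"
  by (induction t arbitrary: x) (auto simp: markov_chain_def intro!: sum_nonneg)

text \<open>
  Some state has positive mass, and some power of the chain carries part of it to \<open>y\<close> without changing \<open>\<pi>\<close>.
\<close>

lemma irreducible_stationary_pos:
  assumes "markov_chain P" "irreducible_chain P" "stationary_distribution P \<pi>"
  shows "0 < \<pi> y"
proof -
  have one: "sum \<pi> UNIV = 1" and nonneg: "\<And>x. 0 \<le> \<pi> x"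
    using assms(3) by (auto simp: stationary_distribution_def)
  obtain x where x: "0 < \<pi> x"
    using one nonneg by (metis less_eq_real_def sum.neutral zero_neq_one)
  obtain t where t: "0 < step_prob P t x y" using assms(2) by (auto simp: irreducible_chain_def)
  have "0 < \<pi> x * step_prob P t x y" using x t by simp
  also have "\<dots> \<le> (\<Sum>x\<in>UNIV. \<pi> x * step_prob P t x y)"
    using nonneg step_prob_nonneg[OF assms(1)] by (intro member_le_sum) auto
  finally show ?thesis by (simp add: stationary_step_prob[OF assms(3)])
qed

text \<open>
  With the strict inequality, a state \<open>y\<close> of positive mass belongs to the set at the levels below \<open>Q(A,y) / \<pi> y\<close> and no
  longer at that level itself. For a lazy chain this makes the set contain \<open>A\<close> at all levels below one half
  and lie within \<open>A\<close> from one half on.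
\<close>

definition evolving_set :: "('v::finite \<Rightarrow> 'v \<Rightarrow> real) \<Rightarrow> ('v \<Rightarrow> real) \<Rightarrow> 'v set \<Rightarrow> real \<Rightarrow> 'v set" where
  "evolving_set P \<pi> A u = {y. u * \<pi> y < ergodic_flow P \<pi> A {y}}"

text \<open>
  Each of the finitely many sets \<open>S\<close> is attained on a Borel set of levels, because attaining it is a finite conjunction
  of linear inequalities in \<open>u\<close>.
\<close>

lemma evolving_set_integrable:
  fixes g :: "'v::finite set \<Rightarrow> real"
  shows "(\<lambda>u. g (evolving_set P \<pi> A u)) integrable_on {c..d}"
proof -
  define E where "E S = {u. evolving_set P \<pi> A u = S}" for S
  have "E S = (\<Inter>y\<in>S. {u. u * \<pi> y < ergodic_flow P \<pi> A {y}}) \<inter>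
      (\<Inter>y\<in>-S. {u. ergodic_flow P \<pi> A {y} \<le> u * \<pi> y})" for S
    unfolding E_def evolving_set_def by (auto simp flip: not_less)
  moreover have "(\<Inter>y\<in>S. {u. u * \<pi> y < ergodic_flow P \<pi> A {y}}) \<inter>
      (\<Inter>y\<in>-S. {u. ergodic_flow P \<pi> A {y} \<le> u * \<pi> y}) \<in> sets borel" for S :: "'v set"
    by (intro sets.Int sets.countable_INT'') auto
  ultimately have "E S \<inter> {c..d} \<in> sets borel" for S by (simp only: sets.Int borel_closed closed_atLeastAtMost)
  then have "E S \<inter> {c..d} \<in> lmeasurable" for S
    by (intro bounded_set_imp_lmeasurable bounded_Int) simp_all
  then have "indicat_real (E S) integrable_on {c..d}" for S by (simp add: integrable_on_indicator)
  then have "(\<lambda>u. \<Sum>S\<in>UNIV. g S * indicat_real (E S) u) integrable_on {c..d}"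
    by (intro integrable_sum integrable_on_mult_right) auto
  moreover have "(\<Sum>S\<in>UNIV. g S * indicat_real (E S) u) = g (evolving_set P \<pi> A u)" for u
    by (simp add: E_def indicator_def if_distrib cong: if_cong)
  ultimately show ?thesis by simp
qed

lemma has_integral_below:
  fixes b c :: real
  assumes "0 \<le> b" "0 \<le> c"
  shows "((\<lambda>u. if u < c then 1 else 0) has_integral min c b) {0..b}"
proof -
  have 1: "((\<lambda>u. if u < c then 1 else 0) has_integral min c b - 0) {0..min c b}"
  proof (rule has_integral_spike[of "{c}"])
    show "((\<lambda>u. 1::real) has_integral min c b - 0) {0..min c b}"
      using has_integral_const_real[of "1::real" 0 "min c b"] assms by simp
  qed auto
  have 2: "((\<lambda>u. if u < c then 1 else 0) has_integral 0) {min c b..b}"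
    by (rule has_integral_spike[OF _ _ has_integral_0, of "{b}"]) (auto simp: min_def split: if_splits)
  show ?thesis using has_integral_combine[OF _ _ 1 2] assms by auto
qed

definition set_deviation :: "('v::finite \<Rightarrow> 'v \<Rightarrow> real) \<Rightarrow> ('v \<Rightarrow> real) \<Rightarrow> nat \<Rightarrow> 'v set \<Rightarrow> real" where
  "set_deviation P \<pi> t A = (\<Sum>y\<in>UNIV. \<bar>(\<Sum>x\<in>A. \<pi> x * step_prob P t x y) - sum \<pi> A * \<pi> y\<bar>) / 2"

text \<open>
  Positivity of \<open>\<pi>\<close> is what the argument takes from irreducibility. Assumed in this form, it passes at once to the
  lazy reversible chain behind the spectral gap, which has the same stationary distribution.
\<close>

locale stationary_chain =
  fixes P :: "'v::finite \<Rightarrow> 'v \<Rightarrow> real" and \<pi> :: "'v \<Rightarrow> real"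
  assumes markov: "markov_chain P"
    and stationary: "stationary_distribution P \<pi>"
    and pos: "\<And>x. 0 < \<pi> x"
    and two_states: "CARD('v) \<ge> 2"
begin

abbreviation "evol \<equiv> evolving_set P \<pi>"
abbreviation "flow A y \<equiv> ergodic_flow P \<pi> A {y}"

lemma P_nonneg: "0 \<le> P x y" and P_sum: "(\<Sum>y\<in>UNIV. P x y) = 1"
  using markov by (auto simp: markov_chain_def)

lemma total: "sum \<pi> UNIV = 1" and balance: "(\<Sum>x\<in>UNIV. \<pi> x * P x y) = \<pi> y"
  using stationary by (auto simp: stationary_distribution_def)

lemma mass_nonneg: "0 \<le> sum \<pi> A" using pos by (intro sum_nonneg) (auto intro: less_imp_le)

lemma mass_compl: "sum \<pi> (- A) = 1 - sum \<pi> A"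
  using sum.union_disjoint[of A "- A" \<pi>] total by (simp add: Compl_partition)

lemma mass_le_1: "sum \<pi> A \<le> 1" using mass_compl[of A] mass_nonneg[of "- A"] by simp

lemma pi_min_le: "pi_min \<pi> \<le> \<pi> x" unfolding pi_min_def by (intro Min_le) auto

lemma pi_min_attained: "\<exists>x. \<pi> x = pi_min \<pi>"
proof -
  have "pi_min \<pi> \<in> range \<pi>" unfolding pi_min_def by (intro Min_in) auto
  then show ?thesis by (auto intro: sym)
qed

lemma pi_min_pos: "0 < pi_min \<pi>" using pi_min_attained pos by metis

lemma pi_min_le_diff: "A \<subset> B \<Longrightarrow> sum \<pi> A + pi_min \<pi> \<le> sum \<pi> B"
proof -
  assume AB: "A \<subset> B"
  then obtain x where x: "x \<in> B" "x \<notin> A" by auto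
  have "sum \<pi> (insert x A) \<le> sum \<pi> B"
    using AB x pos by (intro sum_mono2) (auto intro: less_imp_le)
  then show ?thesis using x pi_min_le[of x] by simp
qed

lemma pi_min_le_mass: "A \<noteq> {} \<Longrightarrow> pi_min \<pi> \<le> sum \<pi> A"
  using pi_min_le_diff[of "{}" A] by auto

lemma pi_min_le_half: "pi_min \<pi> \<le> 1/2"
proof -
  have "real 2 * pi_min \<pi> \<le> real CARD('v) * pi_min \<pi>"
    using two_states pi_min_pos by (intro mult_right_mono) auto
  also have "\<dots> \<le> sum \<pi> UNIV" using sum_bounded_below[of UNIV "pi_min \<pi>" \<pi>] pi_min_le by simp
  finally show ?thesis by (simp add: total)
qed

lemma small_set_exists: "\<exists>A. A \<noteq> {} \<and> sum \<pi> A \<le> 1/2"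
proof -
  obtain x where "\<pi> x = pi_min \<pi>" using pi_min_attained by blast
  then show ?thesis using pi_min_le_half by (intro exI[of _ "{x}"]) simp
qed

lemma flow_nonneg: "0 \<le> flow A y"
  unfolding ergodic_flow_def using pos P_nonneg by (intro sum_nonneg mult_nonneg_nonneg) (auto intro: less_imp_le)

lemma flow_mono: "A \<subseteq> B \<Longrightarrow> flow A y \<le> flow B y"
  unfolding ergodic_flow_def using pos P_nonneg by (intro sum_mono2 sum_nonneg mult_nonneg_nonneg) (auto intro: less_imp_le)

lemma flow_le: "flow A y \<le> \<pi> y"
  using flow_mono[of A UNIV y] balance[of y] by (simp add: ergodic_flow_def)

lemma evol_iff: "y \<in> evol A u \<longleftrightarrow> u < flow A y / \<pi> y"
  using pos[of y] by (simp add: evolving_set_def field_simps)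

text \<open>
  Each state contributes its weight times the length of the interval of levels at which it belongs to the evolving
  set.
\<close>

lemma integral_sum_evol:
  fixes h :: "'v \<Rightarrow> real"
  assumes "0 \<le> b"
  shows "integral {0..b} (\<lambda>u. \<Sum>y\<in>evol A u. h y) = (\<Sum>y\<in>UNIV. h y * min (flow A y / \<pi> y) b)"
proof -
  have "0 \<le> flow A y / \<pi> y" for y using flow_nonneg[of A y] pos[of y] by simp
  then have "((\<lambda>u. \<Sum>y\<in>UNIV. h y * (if u < flow A y / \<pi> y then 1 else 0)) has_integral
      (\<Sum>y\<in>UNIV. h y * min (flow A y / \<pi> y) b)) {0..b}"
    using assms by (intro has_integral_sum has_integral_mult_right has_integral_below) auto
  moreover have "(\<Sum>y\<in>UNIV. h y * (if u < flow A y / \<pi> y then 1 else 0)) = (\<Sum>y\<in>evol A u. h y)" for u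
    by (simp add: if_distrib sum.If_cases evol_iff[symmetric] cong: if_cong)
  ultimately show ?thesis by (simp add: integral_unique)
qed

lemma integral_sum_evol_unit:
  "integral {0..1} (\<lambda>u. \<Sum>y\<in>evol A u. \<pi> y * h y) = (\<Sum>y\<in>UNIV. flow A y * h y)"
proof -
  have "\<pi> y * h y * min (flow A y / \<pi> y) 1 = flow A y * h y" for y
    using pos[of y] flow_le[of A y] by (simp add: min_def field_simps)
  then show ?thesis by (simp only: integral_sum_evol zero_le_one)
qed

lemma mass_evol_martingale: "integral {0..1} (\<lambda>u. sum \<pi> (evol A u)) = sum \<pi> A"
proof -
  have "(\<Sum>y\<in>UNIV. flow A y) = (\<Sum>x\<in>A. \<pi> x * (\<Sum>y\<in>UNIV. P x y))"
    unfolding ergodic_flow_def by (subst sum.swap) (simp add: sum_distrib_left)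
  then show ?thesis using integral_sum_evol_unit[where h = "\<lambda>_. 1" and A = A] by (simp add: P_sum)
qed

text \<open>
  The mass that \<open>A\<close> sends out in the first step lies on the states of \<open>A\<^sub>u\<close> as an average of \<open>\<pi>\<close> restricted to these
  sets.
\<close>

lemma flow_step_evol:
  "(\<Sum>x\<in>A. \<pi> x * step_prob P (Suc t) x y) =
     integral {0..1} (\<lambda>u. \<Sum>z\<in>evol A u. \<pi> z * step_prob P t z y)"
proof -
  have "(\<Sum>x\<in>A. \<pi> x * step_prob P (Suc t) x y) = (\<Sum>x\<in>A. \<Sum>z\<in>UNIV. \<pi> x * P x z * step_prob P t z y)"
    by (simp add: sum_distrib_left mult.assoc)
  also have "\<dots> = (\<Sum>z\<in>UNIV. flow A z * step_prob P t z y)"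
    by (subst sum.swap) (simp add: ergodic_flow_def sum_distrib_right)
  finally show ?thesis by (simp add: integral_sum_evol_unit)
qed

text \<open>
  The triangle inequality for the average over levels. The centring term \<open>\<pi>(A) * \<pi> y\<close> is averaged as well, because the
  mass of the evolving set is a martingale.
\<close>

lemma set_deviation_Suc:
  "set_deviation P \<pi> (Suc t) A \<le> integral {0..1} (\<lambda>u. set_deviation P \<pi> t (evol A u))"
proof -
  define F where "F S y = (\<Sum>x\<in>S. \<pi> x * step_prob P t x y) - sum \<pi> S * \<pi> y" for S y
  have *: "\<bar>(\<Sum>x\<in>A. \<pi> x * step_prob P (Suc t) x y) - sum \<pi> A * \<pi> y\<bar>
      \<le> integral {0..1} (\<lambda>u. \<bar>F (evol A u) y\<bar>)" for y
  proof -
    have "(\<Sum>x\<in>A. \<pi> x * step_prob P (Suc t) x y) - sum \<pi> A * \<pi> y = integral {0..1} (\<lambda>u. F (evol A u) y)"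
      unfolding F_def flow_step_evol
      using integral_diff[OF
          evolving_set_integrable[where g = "\<lambda>S. \<Sum>x\<in>S. \<pi> x * step_prob P t x y"]
          evolving_set_integrable[where g = "\<lambda>S. sum \<pi> S * \<pi> y"]]
      by (simp add: mass_evol_martingale)
    also have "\<bar>\<dots>\<bar> \<le> integral {0..1} (\<lambda>u. \<bar>F (evol A u) y\<bar>)"
      using integral_norm_bound_integral[of "\<lambda>u. F (evol A u) y" "{0..1}" "\<lambda>u. \<bar>F (evol A u) y\<bar>"]
      by (simp add: evolving_set_integrable[where g = "\<lambda>S. F S y"] evolving_set_integrable[where g = "\<lambda>S. \<bar>F S y\<bar>"])
    finally show ?thesis .
  qed
  have "set_deviation P \<pi> (Suc t) A \<le> (\<Sum>y\<in>UNIV. integral {0..1} (\<lambda>u. \<bar>F (evol A u) y\<bar>)) / 2"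
    unfolding set_deviation_def by (intro divide_right_mono sum_mono *) auto
  also have "\<dots> = integral {0..1} (\<lambda>u. (\<Sum>y\<in>UNIV. \<bar>F (evol A u) y\<bar>) / 2)"
    by (simp add: integral_sum evolving_set_integrable[where g = "\<lambda>S. \<bar>F S y\<bar>" for y])
  finally show ?thesis by (simp add: set_deviation_def F_def)
qed

text \<open>
  The two signed deviations add up to that of the whole space, which is zero by stationarity.
\<close>

lemma set_deviation_compl: "set_deviation P \<pi> t (- A) = set_deviation P \<pi> t A"
proof -
  have "(\<Sum>x\<in>-A. \<pi> x * step_prob P t x y) = \<pi> y - (\<Sum>x\<in>A. \<pi> x * step_prob P t x y)" for y
    using sum.union_disjoint[of A "- A" "\<lambda>x. \<pi> x * step_prob P t x y"] stationary_step_prob[OF stationary, of t y]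
    by (simp add: Compl_partition)
  then have "(\<Sum>x\<in>-A. \<pi> x * step_prob P t x y) - sum \<pi> (- A) * \<pi> y =
      - ((\<Sum>x\<in>A. \<pi> x * step_prob P t x y) - sum \<pi> A * \<pi> y)" for y
    by (simp add: mass_compl algebra_simps)
  then show ?thesis by (simp add: set_deviation_def del: minus_diff_eq)
qed

lemma set_deviation_0: "set_deviation P \<pi> 0 A = sum \<pi> A * (1 - sum \<pi> A)"
proof -
  have "\<bar>(\<Sum>x\<in>A. \<pi> x * step_prob P 0 x y) - sum \<pi> A * \<pi> y\<bar> =
      (if y \<in> A then sum \<pi> (- A) * \<pi> y else sum \<pi> A * \<pi> y)" for y
  proof -
    have "(\<Sum>x\<in>A. \<pi> x * step_prob P 0 x y) = (if y \<in> A then \<pi> y else 0)"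
      by (simp add: if_distrib sum.delta cong: if_cong)
    moreover have "\<bar>\<pi> y - sum \<pi> A * \<pi> y\<bar> = sum \<pi> (- A) * \<pi> y"
      using mult_nonneg_nonneg[OF mass_nonneg[of "- A"] less_imp_le[OF pos[of y]]]
      by (simp add: mass_compl left_diff_distrib)
    moreover have "\<bar>0 - sum \<pi> A * \<pi> y\<bar> = sum \<pi> A * \<pi> y"
      using mult_nonneg_nonneg[OF mass_nonneg[of A] less_imp_le[OF pos[of y]]] by simp
    ultimately show ?thesis by presburger
  qed
  then have "(\<Sum>y\<in>UNIV. \<bar>(\<Sum>x\<in>A. \<pi> x * step_prob P 0 x y) - sum \<pi> A * \<pi> y\<bar>) =
      sum \<pi> (- A) * sum \<pi> A + sum \<pi> A * sum \<pi> (- A)"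
    by (simp add: sum.If_cases sum_distrib_left Compl_eq)
  then show ?thesis by (simp add: set_deviation_def mass_compl algebra_simps)
qed

section \<open>Convergence from contraction of the sine\<close>

definition sine_contraction :: "real \<Rightarrow> bool" where
  "sine_contraction C \<longleftrightarrow> (\<forall>A. A \<noteq> {} \<longrightarrow> sum \<pi> A \<le> 1/2 \<longrightarrow>
     integral {0..1} (\<lambda>u. sin (pi * sum \<pi> (evol A u))) \<le> C * sin (pi * sum \<pi> A))"

lemma sine_contraction_nonneg:
  assumes "sine_contraction C" shows "0 \<le> C"
proof -
  obtain A where A: "A \<noteq> {}" "sum \<pi> A \<le> 1/2" using small_set_exists by blast
  have "0 \<le> integral {0..1} (\<lambda>u. sin (pi * sum \<pi> (evol A u)))"
    by (intro integral_nonneg evolving_set_integrable[where g = "\<lambda>S. sin (pi * sum \<pi> S)"]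
        sin_pi_nonneg mass_nonneg mass_le_1)
  also have "\<dots> \<le> C * sin (pi * sum \<pi> A)" using assms A by (simp add: sine_contraction_def)
  finally show ?thesis
    using sin_pi_pos[of "sum \<pi> A"] A pi_min_le_mass[OF A(1)] pi_min_pos by (simp add: zero_le_mult_iff)
qed

text \<open>
  Induction on time. In each step a set of mass above one half is first replaced by its complement; this changes neither side, and
  so contraction is only required for small sets.
\<close>

lemma set_deviation_decay:
  assumes C: "sine_contraction C"
  shows "set_deviation P \<pi> t A \<le>
    C ^ t * (pi_min \<pi> * (1 - pi_min \<pi>) / sin (pi * pi_min \<pi>) * sin (pi * sum \<pi> A))"
proof (induction t arbitrary: A)
  case 0
  show ?case
  proof (cases "A = {} \<or> A = UNIV")
    case True
    then show ?thesis by (elim disjE) (simp_all add: set_deviation_0 total)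
  next
    case False
    moreover from False have "- A \<noteq> {}" by auto
    ultimately have "pi_min \<pi> \<le> sum \<pi> A" "pi_min \<pi> \<le> 1 - sum \<pi> A"
      using pi_min_le_mass[of A] pi_min_le_mass[of "- A"] by (simp_all add: mass_compl)
    then show ?thesis
      using parabola_le_sin_pi[OF pi_min_pos, of "sum \<pi> A"] unfolding set_deviation_0 by simp
  qed
next
  case (Suc t)
  define K where "K = pi_min \<pi> * (1 - pi_min \<pi>) / sin (pi * pi_min \<pi>)"
  have K: "0 \<le> K"
    unfolding K_def using pi_min_pos pi_min_le_half
    by (intro divide_nonneg_nonneg mult_nonneg_nonneg sin_pi_nonneg) linarith+
  have C0: "0 \<le> C" using C by (rule sine_contraction_nonneg)
  have small: "set_deviation P \<pi> (Suc t) B \<le> C ^ Suc t * (K * sin (pi * sum \<pi> B))"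
    if B: "sum \<pi> B \<le> 1/2" for B
  proof (cases "B = {}")
    case True
    then show ?thesis by (simp add: set_deviation_def)
  next
    case False
    have "set_deviation P \<pi> (Suc t) B \<le> integral {0..1} (\<lambda>u. set_deviation P \<pi> t (evol B u))"
      by (rule set_deviation_Suc)
    also have "\<dots> \<le> integral {0..1} (\<lambda>u. C ^ t * (K * sin (pi * sum \<pi> (evol B u))))"
      using Suc.IH by (intro integral_le evolving_set_integrable[where g = "set_deviation P \<pi> t"]
          evolving_set_integrable[where g = "\<lambda>S. C ^ t * (K * sin (pi * sum \<pi> S))"]) (simp add: K_def)
    also have "\<dots> = C ^ t * K * integral {0..1} (\<lambda>u. sin (pi * sum \<pi> (evol B u)))" by simp
    also have "\<dots> \<le> C ^ t * K * (C * sin (pi * sum \<pi> B))"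
      using C B False K C0 by (intro mult_left_mono) (auto simp: sine_contraction_def)
    finally show ?thesis by (simp add: mult_ac)
  qed
  show ?case
  proof (cases "sum \<pi> A \<le> 1/2")
    case True
    then show ?thesis using small[of A] by (simp add: K_def)
  next
    case False
    then show ?thesis using small[of "- A"]
      by (simp only: set_deviation_compl mass_compl sin_pi_one_minus) (simp add: K_def)
  qed
qed

text \<open>
  The singleton case of the previous bound, divided by \<open>\<pi> x\<close>. Since \<open>sin (pi * x) / x\<close> decreases, the bound is worst for the
  least likely state, and there the sines cancel.
\<close>

lemma tv_decay:
  assumes C: "sine_contraction C"
  shows "tv_dist (step_prob P t x) \<pi> \<le> (1 - pi_min \<pi>) * C ^ t"
proof -
  define m where "m = pi_min \<pi>"
  have m: "0 < m" "m \<le> \<pi> x" "\<pi> x \<le> 1" "m \<le> 1/2"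
    using pi_min_pos pi_min_le mass_le_1[of "{x}"] pi_min_le_half by (auto simp: m_def)
  have sm: "0 < sin (pi * m)" using m by (intro sin_pi_pos) auto
  have C0: "0 \<le> C" using C by (rule sine_contraction_nonneg)
  have "\<bar>\<pi> x * step_prob P t x y - \<pi> x * \<pi> y\<bar> = \<pi> x * \<bar>step_prob P t x y - \<pi> y\<bar>" for y
    using pos[of x] by (simp add: abs_mult flip: right_diff_distrib)
  then have "\<pi> x * tv_dist (step_prob P t x) \<pi> = set_deviation P \<pi> t {x}"
    by (simp add: set_deviation_def tv_dist_def sum_distrib_left)
  also have "\<dots> \<le> C ^ t * (m * (1 - m) / sin (pi * m) * sin (pi * \<pi> x))"
    using set_deviation_decay[OF C, of t "{x}"] by (simp add: m_def)
  also have "\<dots> \<le> C ^ t * (m * (1 - m) / sin (pi * m) * (\<pi> x * (sin (pi * m) / m)))"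
  proof (intro mult_left_mono)
    show "sin (pi * \<pi> x) \<le> \<pi> x * (sin (pi * m) / m)"
      using sin_pi_over_id_antimono[of m "\<pi> x"] m by (simp add: field_simps)
  qed (use m sm C0 in auto)
  also have "\<dots> = \<pi> x * ((1 - m) * C ^ t)" using m sm by (simp add: field_simps)
  finally show ?thesis using pos[of x] by (simp add: m_def)
qed

lemma mixing_time_bound:
  assumes C: "sine_contraction C" "C < 1" and e: "0 < e"
  shows "mixing_time_le P \<pi> e (inverse_neg_ln C * ln ((1 - pi_min \<pi>) / e))"
  unfolding mixing_time_le_def
proof (intro allI impI)
  fix t :: nat and x
  assume t: "0 < t \<and> inverse_neg_ln C * ln ((1 - pi_min \<pi>) / e) \<le> real t"
  have m: "0 < 1 - pi_min \<pi>" using pi_min_le_half by simp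
  have "(1 - pi_min \<pi>) * C ^ t \<le> e"
  proof (cases "C = 0")
    case True
    then show ?thesis using t e by (simp add: zero_power)
  next
    case False
    then have C0: "0 < C" using sine_contraction_nonneg[OF C(1)] by simp
    then have "ln C < 0" using C(2) by simp
    then have "ln ((1 - pi_min \<pi>) / e) \<le> real t * - ln C"
      using t False by (simp add: inverse_neg_ln_def field_simps)
    then have "ln ((1 - pi_min \<pi>) * C ^ t) \<le> ln e"
      using m e C0 by (simp add: ln_div ln_mult ln_realpow)
    then show ?thesis using m e C0 by simp
  qed
  then show "tv_dist (step_prob P t x) \<pi> \<le> e" using tv_decay[OF C(1), of t x] by linarith
qed

section \<open>Eigenvalues\<close>

text \<open>
  A mean zero function does not see the part of \<open>P\<^sup>t(x,\<cdot>)\<close> that is equal to \<open>\<pi>\<close>.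
\<close>

lemma step_average_decay:
  fixes f :: "'v \<Rightarrow> 'b::real_normed_vector"
  assumes C: "sine_contraction C" and mean: "(\<Sum>y\<in>UNIV. \<pi> y *\<^sub>R f y) = 0"
  shows "norm (\<Sum>y\<in>UNIV. step_prob P t x y *\<^sub>R f y) \<le> 2 * (1 - pi_min \<pi>) * (\<Sum>y\<in>UNIV. norm (f y)) * C ^ t"
proof -
  define N where "N = (\<Sum>y\<in>UNIV. norm (f y))"
  have N: "norm (f y) \<le> N" for y unfolding N_def by (intro member_le_sum) auto
  have N0: "0 \<le> N" unfolding N_def by (intro sum_nonneg) auto
  have "(\<Sum>y\<in>UNIV. step_prob P t x y *\<^sub>R f y) = (\<Sum>y\<in>UNIV. (step_prob P t x y - \<pi> y) *\<^sub>R f y)"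
    by (simp add: scaleR_diff_left sum_subtractf mean)
  also have "norm \<dots> \<le> (\<Sum>y\<in>UNIV. \<bar>step_prob P t x y - \<pi> y\<bar> * N)"
    by (rule order.trans[OF norm_sum]) (auto intro!: sum_mono mult_left_mono N)
  also have "\<dots> = 2 * tv_dist (step_prob P t x) \<pi> * N"
    by (simp add: tv_dist_def sum_distrib_right)
  also have "\<dots> \<le> 2 * ((1 - pi_min \<pi>) * C ^ t) * N"
    using tv_decay[OF C] N0 by (intro mult_right_mono mult_left_mono) auto
  finally show ?thesis by (simp only: N_def mult_ac)
qed

lemma eigenvalue_le_contraction:
  assumes C: "sine_contraction C" and l: "chain_eigenvalue P l" "l \<noteq> 1"
  shows "cmod l \<le> C"
proof -
  obtain f x where fx: "f x \<noteq> 0" and ev: "\<And>x. (\<Sum>y\<in>UNIV. of_real (P x y) * f y) = l * f x"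
    using l by (auto simp: chain_eigenvalue_def)
  \<comment> \<open>stationarity gives \<open>l * m = m\<close>, so that eigenfunctions for \<open>l \<noteq> 1\<close> have mean zero\<close>
  define m where "m = (\<Sum>x\<in>UNIV. \<pi> x *\<^sub>R f x)"
  have "l * m = (\<Sum>x\<in>UNIV. \<Sum>y\<in>UNIV. of_real (\<pi> x * P x y) * f y)"
    by (simp add: m_def sum_distrib_left scaleR_conv_of_real mult.left_commute[of l] ev[symmetric] mult.assoc)
  also have "\<dots> = (\<Sum>y\<in>UNIV. of_real (\<Sum>x\<in>UNIV. \<pi> x * P x y) * f y)"
    by (subst sum.swap) (simp add: sum_distrib_right)
  also have "\<dots> = m" by (simp only: balance m_def scaleR_conv_of_real)
  finally have m0: "m = 0" using l(2) by simp
  have pow: "(\<Sum>y\<in>UNIV. step_prob P t x y *\<^sub>R f y) = l ^ t * f x" for t x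
  proof (induction t arbitrary: x)
    case 0
    then show ?case by (simp add: if_distrib[of "\<lambda>c. c *\<^sub>R _"] cong: if_cong)
  next
    case (Suc t)
    have "(\<Sum>y\<in>UNIV. step_prob P (Suc t) x y *\<^sub>R f y) =
        (\<Sum>z\<in>UNIV. P x z *\<^sub>R (\<Sum>y\<in>UNIV. step_prob P t z y *\<^sub>R f y))"
      by (simp add: scaleR_sum_left scaleR_sum_right) (rule sum.swap)
    also have "\<dots> = l ^ t * (\<Sum>z\<in>UNIV. of_real (P x z) * f z)"
      unfolding Suc by (simp add: scaleR_conv_of_real sum_distrib_left mult.left_commute)
    finally show ?case unfolding ev by (simp only: power_Suc mult_ac)
  qed
  define K where "K = 2 * (1 - pi_min \<pi>) * (\<Sum>y\<in>UNIV. norm (f y)) / cmod (f x)"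
  have "cmod l ^ t \<le> K * C ^ t" for t
    using step_average_decay[OF C m0[unfolded m_def], of t x] fx
    by (simp add: pow norm_mult norm_power K_def field_simps)
  then show ?thesis using sine_contraction_nonneg[OF C] by (rule le_of_powers_dominated)
qed

section \<open>Evolving sets spread by the modified vertex flow\<close>

text \<open>
  Adding states in the order of increasing \<open>q\<close> until the mass would exceed \<open>s\<close>. Here \<open>B\<close> is a maximal set that is closed
  under smaller values of \<open>q\<close> and has mass at most \<open>s\<close>, and \<open>v\<close> is the next state in the order.
\<close>

lemma greedy_prefix_exists:
  fixes q :: "'v \<Rightarrow> real"
  assumes s: "0 \<le> s" "s < 1"
  obtains B v where "\<And>y. y \<in> B \<Longrightarrow> q y \<le> q v" "\<And>y. y \<notin> B \<Longrightarrow> q v \<le> q y"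
    "sum \<pi> B \<le> s" "s < sum \<pi> (B \<union> {v})"
proof -
  define F where "F = {B. (\<forall>x\<in>B. \<forall>y\<in>-B. q x \<le> q y) \<and> sum \<pi> B \<le> s}"
  have "{} \<in> F" using s by (simp add: F_def)
  then obtain B where B: "B \<in> F" "\<And>B'. B' \<in> F \<Longrightarrow> B \<subseteq> B' \<Longrightarrow> B = B'"
    using finite_has_maximal[of F] by auto
  have "B \<noteq> UNIV" using B(1) s total by (auto simp: F_def)
  then have ne: "q ` (- B) \<noteq> {}" by auto
  have "Min (q ` (- B)) \<in> q ` (- B)" using ne by (intro Min_in) auto
  then obtain v where v: "v \<notin> B" "q v = Min (q ` (- B))" by auto
  have vmin: "q v \<le> q y" if "y \<notin> B" for y unfolding v(2) using that by (intro Min_le) auto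
  have "insert v B \<notin> F" using B(2)[of "insert v B"] v(1) by auto
  moreover have "\<forall>x\<in>insert v B. \<forall>y\<in>- insert v B. q x \<le> q y" using B(1) vmin by (auto simp: F_def)
  ultimately have "s < sum \<pi> (B \<union> {v})" by (auto simp: F_def)
  then show ?thesis using that[of B v] B(1) v(1) vmin by (auto simp: F_def)
qed

lemma finite_Psi_hat_values:
  "finite {(\<Sum>x\<in>B. Q_hat P \<pi> A x) + (sum \<pi> (- A) - sum \<pi> B) / \<pi> v * Q_hat P \<pi> A v | B v.
            sum \<pi> B \<le> sum \<pi> (- A) \<and> sum \<pi> (- A) < sum \<pi> (B \<union> {v})}"
  by (rule finite_subset[of _ "range (\<lambda>(B, v). (\<Sum>x\<in>B. Q_hat P \<pi> A x) +
      (sum \<pi> (- A) - sum \<pi> B) / \<pi> v * Q_hat P \<pi> A v)"]) auto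

text \<open>
  The minimum in \<open>Psi_hat\<close> is bounded by its value at the greedy choice, which takes the states that receive the least from \<open>A\<close>
  relative to their mass. The truncation at \<open>\<pi> y / 2\<close> corresponds to integrating only over levels below one half.
  At a level where \<open>v\<close> belongs to the evolving set, so does every state outside \<open>B\<close>, and the mass counted is exactly
  \<open>\<pi>(A\<^sub>u) - \<pi>(A)\<close>; at any other level no state of \<open>B\<close> belongs to it and nothing is counted.
\<close>

lemma Psi_hat_le_spread:
  assumes A: "A \<noteq> {}"
  shows "Psi_hat P \<pi> A \<le> integral {0..1/2} (\<lambda>u. max 0 (sum \<pi> (evol A u) - sum \<pi> A))"
proof -
  define q where "q y = flow A y / \<pi> y" for y
  define a where "a = sum \<pi> A"
  have a: "0 < a" "a \<le> 1" using pi_min_le_mass[OF A] pi_min_pos mass_le_1[of A] by (auto simp: a_def)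
  obtain B v where B: "\<And>y. y \<in> B \<Longrightarrow> q y \<le> q v" "\<And>y. y \<notin> B \<Longrightarrow> q v \<le> q y"
    "sum \<pi> B \<le> 1 - a" "1 - a < sum \<pi> (B \<union> {v})"
    using greedy_prefix_exists[of "1 - a" q] a by auto
  \<comment> \<open>the part of the mass of \<open>v\<close> that completes \<open>B\<close> to mass \<open>1 - a\<close>\<close>
  define c where "c = 1 - a - sum \<pi> B"
  define h where "h y = (if y \<in> B then \<pi> y else 0) + (if y = v then c else 0)" for y
  have Qh: "Q_hat P \<pi> A y = \<pi> y * min (q y) (1/2)" for y
    using pos[of y] by (simp add: Q_hat_def q_def min_def field_simps)
  have sum_h: "(\<Sum>y\<in>S. h y * k y) = (\<Sum>y\<in>S \<inter> B. \<pi> y * k y) + (if v \<in> S then c * k v else 0)"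
    for S :: "'v set" and k :: "'v \<Rightarrow> real"
  proof -
    have "(\<Sum>y\<in>S. h y * k y) =
        (\<Sum>y\<in>S. if y \<in> B then \<pi> y * k y else 0) + (\<Sum>y\<in>S. if y = v then c * k y else 0)"
      by (auto simp: h_def distrib_right sum.distrib if_distrib[of "\<lambda>z. z * _"] cong: if_cong)
    then show ?thesis by (simp add: sum.inter_restrict)
  qed
  have "Psi_hat P \<pi> A \<le> (\<Sum>x\<in>B. Q_hat P \<pi> A x) + (sum \<pi> (- A) - sum \<pi> B) / \<pi> v * Q_hat P \<pi> A v"
    unfolding Psi_hat_def using B(3,4)
    by (intro Min_le finite_Psi_hat_values) (auto simp: mass_compl a_def)
  also have "\<dots> = (\<Sum>y\<in>UNIV. h y * min (q y) (1/2))"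
    using pos[of v] by (simp add: sum_h Qh mass_compl c_def a_def)
  also have "\<dots> = integral {0..1/2} (\<lambda>u. \<Sum>y\<in>evol A u. h y)"
    using integral_sum_evol[where b = "1/2" and h = h and A = A] by (simp add: q_def)
  also have "\<dots> \<le> integral {0..1/2} (\<lambda>u. max 0 (sum \<pi> (evol A u) - a))"
  proof (intro integral_le evolving_set_integrable[where g = "\<lambda>S. sum h S"]
      evolving_set_integrable[where g = "\<lambda>S. max 0 (sum \<pi> S - a)"])
    fix u :: real
    have *: "sum h (evol A u) = sum \<pi> (evol A u \<inter> B) + (if v \<in> evol A u then c else 0)"
      using sum_h[of "\<lambda>_. 1" "evol A u"] by simp
    show "sum h (evol A u) \<le> max 0 (sum \<pi> (evol A u) - a)"
    proof (cases "v \<in> evol A u")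
      case True
      then have "- B \<subseteq> evol A u" using B(2) by (force simp: evol_iff q_def)
      then have "evol A u = (evol A u \<inter> B) \<union> - B" by auto
      then have "sum \<pi> (evol A u) = sum \<pi> (evol A u \<inter> B) + sum \<pi> (- B)"
        using sum.union_disjoint[of "evol A u \<inter> B" "- B" \<pi>] by auto
      then show ?thesis using True by (simp add: * c_def mass_compl)
    next
      case False
      then have "evol A u \<inter> B = {}" using B(1) by (force simp: evol_iff q_def)
      then show ?thesis using False by (simp add: *)
    qed
  qed
  finally show ?thesis by (simp add: a_def)
qed

lemma Psi_hat_nonneg:
  assumes A: "A \<noteq> {}" shows "0 \<le> Psi_hat P \<pi> A"
proof -
  have s: "0 \<le> sum \<pi> (- A)" "sum \<pi> (- A) < 1"
    using pi_min_le_mass[OF A] pi_min_pos mass_nonneg[of "- A"] by (auto simp: mass_compl)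
  obtain B v where "sum \<pi> B \<le> sum \<pi> (- A)" "sum \<pi> (- A) < sum \<pi> (B \<union> {v})"
    using greedy_prefix_exists[OF s, of "\<lambda>_. 0"] by metis
  then show ?thesis
    unfolding Psi_hat_def using finite_Psi_hat_values[of A]
    by (subst Min_ge_iff)
       (auto simp: Q_hat_def flow_nonneg less_imp_le[OF pos] intro!: add_nonneg_nonneg sum_nonneg mult_nonneg_nonneg divide_nonneg_nonneg)
qed

lemma Psi_hat_min_le: "A \<noteq> {} \<Longrightarrow> sum \<pi> A \<le> 1/2 \<Longrightarrow> Psi_hat_min P \<pi> \<le> Psi_hat P \<pi> A"
  unfolding Psi_hat_min_def by (intro Min_le) auto

lemma Psi_hat_min_nonneg: "0 \<le> Psi_hat_min P \<pi>"
proof -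
  have "Psi_hat_min P \<pi> \<in> {Psi_hat P \<pi> A | A. A \<noteq> {} \<and> sum \<pi> A \<le> 1 / 2}"
    unfolding Psi_hat_min_def using small_set_exists by (intro Min_in) simp_all
  then obtain A where "Psi_hat_min P \<pi> = Psi_hat P \<pi> A" "A \<noteq> {}" by blast
  then show ?thesis using Psi_hat_nonneg[of A] by simp
qed

lemma Psi_hat_min_le_half: "Psi_hat_min P \<pi> \<le> 1/2"
proof -
  obtain A where A: "A \<noteq> {}" "sum \<pi> A \<le> 1/2" using small_set_exists by blast
  have "Psi_hat_min P \<pi> \<le> integral {0..1/2} (\<lambda>u. max 0 (sum \<pi> (evol A u) - sum \<pi> A))"
    using Psi_hat_min_le[OF A] Psi_hat_le_spread[OF A(1)] by simp
  also have "\<dots> \<le> integral {0..1/2::real} (\<lambda>u. 1)"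
  proof (intro integral_le evolving_set_integrable[where g = "\<lambda>S. max 0 (sum \<pi> S - sum \<pi> A)"])
    show "max 0 (sum \<pi> (evol A u) - sum \<pi> A) \<le> 1" for u
      using mass_le_1[of "evol A u"] mass_nonneg[of A] by simp
  qed auto
  finally show ?thesis by simp
qed

lemma finite_Delta_values: "finite {\<bar>sum \<pi> A - sum \<pi> B\<bar> | A B. sum \<pi> A \<noteq> sum \<pi> B}"
  by (rule finite_subset[of _ "range (\<lambda>(A, B). \<bar>sum \<pi> A - sum \<pi> B\<bar>)"]) auto

lemma Delta_min_le: "sum \<pi> A \<noteq> sum \<pi> B \<Longrightarrow> Delta_min \<pi> \<le> \<bar>sum \<pi> A - sum \<pi> B\<bar>"
  unfolding Delta_min_def by (intro Min_le finite_Delta_values) auto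

lemma Delta_min_pos: "0 < Delta_min \<pi>"
proof -
  have "sum \<pi> {} \<noteq> sum \<pi> UNIV" using total by simp
  then show ?thesis
    unfolding Delta_min_def using finite_Delta_values by (subst Min_gr_iff) (blast+, auto)
qed

lemma Delta_min_le_1: "Delta_min \<pi> \<le> 1"
  using Delta_min_le[of UNIV "{}"] total by simp

text \<open>
  The two cases are the two regimes of the minimum and the maximum in \<open>A_hat_min\<close> and \<open>A_hat_max\<close>. When \<open>\<psi> > d / 2\<close> the
  quotient of \<open>A_hat_min\<close> by \<open>Delta_min\<close> is \<open>1/2\<close>, and the factor is \<open>cos (2 * pi * \<psi>)\<close>.
\<close>

lemma sine_contraction_Psi_hat:
  "sine_contraction (1 - 2 * (A_hat_min P \<pi> / Delta_min \<pi>) * (1 - cos (2 * pi * A_hat_max P \<pi>)))"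
  unfolding sine_contraction_def
proof (intro allI impI)
  fix A :: "'v set" assume A: "A \<noteq> {}" "sum \<pi> A \<le> 1/2"
  define \<psi> where "\<psi> = Psi_hat_min P \<pi>"
  define d where "d = Delta_min \<pi>"
  define a where "a = sum \<pi> A"
  have a: "0 < a" "a \<le> 1/2" using pi_min_le_mass[OF A(1)] pi_min_pos A(2) by (auto simp: a_def)
  have d: "0 < d" "d \<le> a" "d \<le> 1 - a"
    using Delta_min_pos Delta_min_le[of A "{}"] Delta_min_le[of A UNIV] a total by (auto simp: d_def a_def)
  have int_sin: "(\<lambda>u. sin (pi * sum \<pi> (evol A u))) integrable_on {0..1}"
    by (rule evolving_set_integrable[where g = "\<lambda>S. sin (pi * sum \<pi> S)"])
  have int_mass: "(\<lambda>u. sum \<pi> (evol A u)) integrable_on {0..1}"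
    by (rule evolving_set_integrable[where g = "sum \<pi>"])
  have int_plus: "(\<lambda>u. max 0 (sum \<pi> (evol A u) - a)) integrable_on {0..r}" for r
    by (rule evolving_set_integrable[where g = "\<lambda>S. max 0 (sum \<pi> S - a)"])
  have mean: "integral {0..1} (\<lambda>u. sum \<pi> (evol A u)) = a"
    unfolding a_def by (rule mass_evol_martingale)
  have unit: "0 \<le> sum \<pi> (evol A u) \<and> sum \<pi> (evol A u) \<le> 1" for u
    by (simp add: mass_nonneg mass_le_1)
  have spread: "\<psi> \<le> integral {0..1/2} (\<lambda>u. max 0 (sum \<pi> (evol A u) - a))"
    using Psi_hat_min_le[OF A] Psi_hat_le_spread[OF A(1)] by (simp add: \<psi>_def a_def)
  have spread': "integral {0..1/2} (\<lambda>u. max 0 (sum \<pi> (evol A u) - a)) \<le>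
      integral {0..1} (\<lambda>u. max 0 (sum \<pi> (evol A u) - a))"
    by (intro integral_subset_le int_plus) auto
  show "integral {0..1} (\<lambda>u. sin (pi * sum \<pi> (evol A u))) \<le>
      (1 - 2 * (A_hat_min P \<pi> / Delta_min \<pi>) * (1 - cos (2 * pi * A_hat_max P \<pi>))) * sin (pi * sum \<pi> A)"
  proof (cases "\<psi> \<le> d / 2")
    case True
    have "integral {0..1} (\<lambda>u. sin (pi * sum \<pi> (evol A u))) \<le>
        (1 - 2 * \<psi> / d * (1 - cos (pi * d))) * sin (pi * a)"
    proof (rule integral_sin_spread_chord[where X = "\<lambda>u. sum \<pi> (evol A u)"])
      show "sum \<pi> (evol A u) = a \<or> d \<le> \<bar>sum \<pi> (evol A u) - a\<bar>" for u
        using Delta_min_le[of "evol A u" A] by (auto simp: d_def a_def)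
    qed (use d spread spread' in \<open>simp_all add: unit int_sin int_mass int_plus mean\<close>)
    then show ?thesis using True by (simp add: A_hat_min_def A_hat_max_def \<psi>_def d_def a_def)
  next
    case False
    have "integral {0..1} (\<lambda>u. sin (pi * sum \<pi> (evol A u))) \<le> cos (2 * pi * \<psi>) * sin (pi * a)"
      using a spread Psi_hat_min_nonneg
      by (intro integral_sin_spread_half unit int_sin int_mass int_plus mean) (simp_all add: \<psi>_def)
    then show ?thesis using False d by (simp add: A_hat_min_def A_hat_max_def \<psi>_def d_def a_def)
  qed
qed

text \<open>
  Both quantities in \<open>A_hat_max\<close> are at most \<open>1/2\<close>, so that the argument of the cosine stays within one half period.
\<close>

lemma contraction_factor_less_1:
  assumes "Psi_hat_min P \<pi> \<noteq> 0"
  shows "1 - 2 * (A_hat_min P \<pi> / Delta_min \<pi>) * (1 - cos (2 * pi * A_hat_max P \<pi>)) < 1"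
proof -
  have "0 < Psi_hat_min P \<pi>" using assms Psi_hat_min_nonneg by simp
  then have "0 < A_hat_min P \<pi> / Delta_min \<pi>" and M: "0 < A_hat_max P \<pi>" "A_hat_max P \<pi> \<le> 1/2"
    using Delta_min_pos Delta_min_le_1 Psi_hat_min_le_half by (auto simp: A_hat_min_def A_hat_max_def)
  moreover have "cos (2 * pi * A_hat_max P \<pi>) < cos 0"
    using M by (intro cos_monotone_0_pi) auto
  ultimately have "0 < A_hat_min P \<pi> / Delta_min \<pi> * (1 - cos (2 * pi * A_hat_max P \<pi>))"
    by (intro mult_pos_pos) auto
  then show ?thesis by simp
qed

section \<open>The spectral gap\<close>

text \<open>
  Let \<open>b t\<close> be the squared norm of the \<open>t\<close>-th iterate of \<open>g\<close>. Self-adjointness and the Cauchy-Schwarz inequality give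
  \<open>(b (t + 1))\<^sup>2 \<le> b t * b (t + 2)\<close>, so the ratios of successive terms increase, and the first ratio is at most the
  exponential rate of decay, which is at most \<open>C\<^sup>2\<close>. One more use of Cauchy-Schwarz bounds the quadratic form.
\<close>

lemma reversible_form_le:
  assumes rev: "\<And>x y. \<pi> x * P x y = \<pi> y * P y x"
    and C: "sine_contraction C"
    and mean: "(\<Sum>x\<in>UNIV. \<pi> x * g x) = 0"
  shows "(\<Sum>x\<in>UNIV. \<pi> x * g x * (\<Sum>y\<in>UNIV. P x y * g y)) \<le> C * (\<Sum>x\<in>UNIV. \<pi> x * (g x)\<^sup>2)"
proof -
  define G where "G t x = (\<Sum>y\<in>UNIV. step_prob P t x y * g y)" for t x
  define b where "b t = (\<Sum>x\<in>UNIV. \<pi> x * (G t x)\<^sup>2)" for t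
  have C0: "0 \<le> C" using C by (rule sine_contraction_nonneg)
  have G0: "G 0 = g" by (auto simp: G_def fun_eq_iff if_distrib[of "\<lambda>c. c * _"] cong: if_cong)
  have GSuc: "G (Suc t) x = (\<Sum>z\<in>UNIV. P x z * G t z)" for t x
  proof -
    have "G (Suc t) x = (\<Sum>y\<in>UNIV. \<Sum>z\<in>UNIV. P x z * (step_prob P t z y * g y))"
      by (simp add: G_def sum_distrib_right mult.assoc)
    also have "\<dots> = (\<Sum>z\<in>UNIV. P x z * G t z)"
      by (subst sum.swap) (simp add: G_def sum_distrib_left)
    finally show ?thesis .
  qed
  have CS: "(\<Sum>x\<in>UNIV. \<pi> x * h x * k x)\<^sup>2 \<le> (\<Sum>x\<in>UNIV. \<pi> x * (h x)\<^sup>2) * (\<Sum>x\<in>UNIV. \<pi> x * (k x)\<^sup>2)"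
    for h k :: "'v \<Rightarrow> real"
  proof -
    have s: "sqrt (\<pi> x) * sqrt (\<pi> x) = \<pi> x" for x using pos[of x] by simp
    have prod: "sqrt (\<pi> x) * h x * (sqrt (\<pi> x) * k x) = \<pi> x * h x * k x" for x
      by (metis s mult.assoc mult.left_commute)
    then show ?thesis
      using Cauchy_Schwarz_ineq_sum[of "\<lambda>x. sqrt (\<pi> x) * h x" "\<lambda>x. sqrt (\<pi> x) * k x" UNIV]
      by (simp only: prod)
         (simp add: power_mult_distrib less_imp_le[OF pos])
  qed
  have adjoint: "(\<Sum>x\<in>UNIV. \<pi> x * (\<Sum>y\<in>UNIV. P x y * h y) * k x) =
      (\<Sum>x\<in>UNIV. \<pi> x * h x * (\<Sum>y\<in>UNIV. P x y * k y))" for h k :: "'v \<Rightarrow> real"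
  proof -
    have "(\<Sum>x\<in>UNIV. \<pi> x * (\<Sum>y\<in>UNIV. P x y * h y) * k x) =
        (\<Sum>x\<in>UNIV. \<Sum>y\<in>UNIV. (\<pi> x * P x y) * h y * k x)"
      by (simp add: sum_distrib_left sum_distrib_right mult.assoc)
    also have "\<dots> = (\<Sum>x\<in>UNIV. \<Sum>y\<in>UNIV. (\<pi> y * P y x) * h x * k y)"
      by (rule sum.swap)
    also have "\<dots> = (\<Sum>x\<in>UNIV. \<Sum>y\<in>UNIV. (\<pi> x * P x y) * h x * k y)" by (simp only: rev)
    also have "\<dots> = (\<Sum>x\<in>UNIV. \<pi> x * h x * (\<Sum>y\<in>UNIV. P x y * k y))"
      by (simp add: sum_distrib_left mult_ac)
    finally show ?thesis .
  qed
  have b_nonneg: "0 \<le> b t" for t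
    unfolding b_def using pos by (intro sum_nonneg mult_nonneg_nonneg) (auto intro: less_imp_le)
  have log_convex: "(b (Suc t))\<^sup>2 \<le> b t * b (Suc (Suc t))" for t
  proof -
    have "b (Suc t) = (\<Sum>x\<in>UNIV. \<pi> x * G t x * G (Suc (Suc t)) x)"
      using adjoint[of "G t" "G (Suc t)"]
      unfolding b_def power2_eq_square by (simp add: GSuc mult.assoc)
    then show ?thesis using CS[of "G t" "G (Suc (Suc t))"] by (simp add: b_def)
  qed
  show ?thesis
  proof (cases "b 0 = 0")
    case True
    then have "(\<Sum>x\<in>UNIV. \<pi> x * g x * G 1 x)\<^sup>2 \<le> 0"
      using CS[of g "G 1"] by (simp add: b_def G0)
    then show ?thesis using True by (simp add: b_def G0 GSuc)
  next
    case False
    then have b0: "0 < b 0" using b_nonneg[of 0] by linarith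
    define r where "r = b 1 / b 0"
    have r: "0 \<le> r" unfolding r_def using b_nonneg by simp
    have step: "r * b t \<le> b (Suc t)" for t
    proof (induction t)
      case 0
      then show ?case using b0 by (simp add: r_def)
    next
      case (Suc t)
      show ?case
      proof (cases "b (Suc t) = 0")
        case True
        then show ?thesis using b_nonneg by simp
      next
        case False
        then have "0 < b (Suc t)" using b_nonneg[of "Suc t"] by linarith
        have "r * b (Suc t) * b t \<le> (b (Suc t))\<^sup>2"
          using mult_right_mono[OF Suc b_nonneg[of "Suc t"]] by (simp add: power2_eq_square mult_ac)
        also have "\<dots> \<le> b (Suc (Suc t)) * b t" using log_convex[of t] by (simp add: mult.commute)
        finally have "r * b (Suc t) * b t \<le> b (Suc (Suc t)) * b t" .
        moreover have "0 < b t"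
          using log_convex[of t] \<open>0 < b (Suc t)\<close> b_nonneg[of t]
          by (metis less_eq_real_def mult_zero_left not_less zero_less_power)
        ultimately show ?thesis by (simp add: mult_le_cancel_right)
      qed
    qed
    have pow: "r ^ t * b 0 \<le> b t" for t
    proof (induction t)
      case (Suc t)
      then have "r * (r ^ t * b 0) \<le> r * b t" using r by (rule mult_left_mono)
      then show ?case using step[of t] by (simp add: mult.assoc)
    qed simp
    define K where "K = 2 * (1 - pi_min \<pi>) * (\<Sum>y\<in>UNIV. norm (g y))"
    have bound: "b t \<le> (K * C ^ t)\<^sup>2" for t
    proof -
      have "(G t x)\<^sup>2 \<le> (K * C ^ t)\<^sup>2" for x
        using step_average_decay[OF C, of g t x] mean
        by (intro power2_le_iff_abs_le[THEN iffD2]) (auto simp: G_def K_def intro: order.trans[OF abs_ge_zero])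
      then have "b t \<le> (\<Sum>x\<in>UNIV. \<pi> x * (K * C ^ t)\<^sup>2)"
        unfolding b_def using pos by (intro sum_mono mult_left_mono) (auto intro: less_imp_le)
      also have "\<dots> = (K * C ^ t)\<^sup>2" by (simp add: total flip: sum_distrib_right)
      finally show ?thesis .
    qed
    have "r ^ t \<le> K\<^sup>2 / b 0 * (C\<^sup>2) ^ t" for t
      using order.trans[OF pow[of t] bound[of t]] b0
      by (simp add: field_simps power_mult_distrib power_mult[symmetric] mult.commute)
    then have "r \<le> C\<^sup>2" by (rule le_of_powers_dominated) simp
    then have "b 1 \<le> C\<^sup>2 * b 0" using b0 by (simp add: r_def field_simps)
    then have "b 0 * b 1 \<le> (C * b 0)\<^sup>2"
      using b0 by (simp add: power2_eq_square mult_ac)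
    then have "(\<Sum>x\<in>UNIV. \<pi> x * g x * G 1 x)\<^sup>2 \<le> (C * b 0)\<^sup>2"
      using CS[of g "G 1"] by (simp add: b_def G0)
    then have "(\<Sum>x\<in>UNIV. \<pi> x * g x * G 1 x) \<le> C * b 0"
      using C0 b0 by (rule_tac power2_le_imp_le) simp_all
    then show ?thesis by (simp add: b_def G0 GSuc)
  qed
qed

lemma half_sum_squares:
  assumes row: "\<And>x. (\<Sum>y\<in>UNIV. K x y) = \<pi> x" and col: "\<And>y. (\<Sum>x\<in>UNIV. K x y) = \<pi> y"
  shows "1/2 * (\<Sum>x\<in>UNIV. \<Sum>y\<in>UNIV. (g x - g y)\<^sup>2 * K x y) =
    (\<Sum>x\<in>UNIV. \<pi> x * (g x)\<^sup>2) - (\<Sum>x\<in>UNIV. \<Sum>y\<in>UNIV. K x y * g x * g y)"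
proof -
  have "(\<Sum>x\<in>UNIV. \<Sum>y\<in>UNIV. (g x - g y)\<^sup>2 * K x y) =
      (\<Sum>x\<in>UNIV. \<Sum>y\<in>UNIV. K x y * (g x)\<^sup>2) + (\<Sum>x\<in>UNIV. \<Sum>y\<in>UNIV. K x y * (g y)\<^sup>2)
      - 2 * (\<Sum>x\<in>UNIV. \<Sum>y\<in>UNIV. K x y * g x * g y)"
    by (simp add: power2_diff algebra_simps sum.distrib sum_subtractf sum_distrib_left)
  also have "(\<Sum>x\<in>UNIV. \<Sum>y\<in>UNIV. K x y * (g y)\<^sup>2) = (\<Sum>y\<in>UNIV. \<Sum>x\<in>UNIV. K x y * (g y)\<^sup>2)"
    by (rule sum.swap)
  finally show ?thesis by (simp add: row col flip: sum_distrib_right)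
qed

text \<open>
  The chain \<open>I/2 + (P + P\<^sup>*)/4\<close>: the additive reversibilization of \<open>P\<close>, made lazy with holding probability one half.
\<close>

definition lazy_reversal :: "'v \<Rightarrow> 'v \<Rightarrow> real" where
  "lazy_reversal x y = (if x = y then 1/2 else 0) + (P x y + \<pi> y * P y x / \<pi> x) / 4"

lemma lazy_reversal_flow:
  "\<pi> x * lazy_reversal x y = (if x = y then \<pi> y / 2 else 0) + (\<pi> x * P x y + \<pi> y * P y x) / 4"
  using pos[of x] by (auto simp: lazy_reversal_def field_simps)

lemma lazy_reversal_reversible: "\<pi> x * lazy_reversal x y = \<pi> y * lazy_reversal y x"
  by (simp add: lazy_reversal_flow)

lemma lazy_reversal_row: "(\<Sum>y\<in>UNIV. \<pi> x * lazy_reversal x y) = \<pi> x"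
proof -
  have "(\<Sum>y\<in>UNIV. \<pi> x * P x y) = \<pi> x" by (simp add: P_sum flip: sum_distrib_left)
  then show ?thesis
    by (simp add: lazy_reversal_flow sum.distrib balance flip: sum_divide_distrib)
qed

lemma stationary_chain_lazy_reversal: "stationary_chain lazy_reversal \<pi>"
proof
  show "markov_chain lazy_reversal"
    unfolding markov_chain_def
  proof (intro conjI allI)
    show "0 \<le> lazy_reversal x y" for x y
      using pos[of x] pos[of y] by (simp add: lazy_reversal_def P_nonneg)
    show "(\<Sum>y\<in>UNIV. lazy_reversal x y) = 1" for x
      using lazy_reversal_row[of x] pos[of x] by (simp flip: sum_distrib_left)
  qed
  show "stationary_distribution lazy_reversal \<pi>"
    using lazy_reversal_row pos total
    by (auto simp: stationary_distribution_def lazy_reversal_reversible[of _ y for y] intro: less_imp_le)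
qed (use pos two_states in auto)

lemma ergodic_flow_lazy_reversal:
  "ergodic_flow lazy_reversal \<pi> A {y} =
    (if y \<in> A then \<pi> y / 2 else 0) + (flow A y + (\<Sum>x\<in>A. \<pi> y * P y x)) / 4"
  by (simp add: ergodic_flow_def lazy_reversal_flow sum.distrib flip: sum_divide_distrib)

lemma Q_min_le: "A \<noteq> {} \<Longrightarrow> A \<noteq> UNIV \<Longrightarrow> Q_min P \<pi> \<le> ergodic_flow P \<pi> A (- A)"
  unfolding Q_min_def by (intro Min_le) auto

text \<open>
  By laziness every state of \<open>A\<close> receives at least half of its mass from \<open>A\<close>, and every other state at most half. The
  evolving set is therefore comparable with \<open>A\<close>, and its mass either equals that of \<open>A\<close> or differs from it by the mass
  of at least one state. The states that it gains have expected mass \<open>(Q(A,A\<^sup>c) + Q(A\<^sup>c,A)) / 4\<close>.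
\<close>

lemma sine_contraction_lazy_reversal:
  "stationary_chain.sine_contraction lazy_reversal \<pi> (1 - Q_min P \<pi> / pi_min \<pi> * (1 - cos (pi * pi_min \<pi>)))"
proof -
  interpret R: stationary_chain lazy_reversal \<pi> by (rule stationary_chain_lazy_reversal)
  show ?thesis
    unfolding R.sine_contraction_def
  proof (intro allI impI)
    fix A :: "'v set" assume A: "A \<noteq> {}" "sum \<pi> A \<le> 1/2"
    define a where "a = sum \<pi> A"
    have proper: "A \<noteq> UNIV" using A(2) total by auto
    then have compl: "- A \<noteq> {}" by auto
    have reversed_nonneg: "0 \<le> (\<Sum>x\<in>A. \<pi> y * P y x)" for y
      using pos[of y] by (intro sum_nonneg mult_nonneg_nonneg P_nonneg) simp
    have reversed_le: "(\<Sum>x\<in>A. \<pi> y * P y x) \<le> \<pi> y" for y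
    proof -
      have "(\<Sum>x\<in>A. \<pi> y * P y x) \<le> (\<Sum>x\<in>UNIV. \<pi> y * P y x)"
        using pos[of y] by (intro sum_mono2 mult_nonneg_nonneg P_nonneg) auto
      then show ?thesis by (simp add: P_sum flip: sum_distrib_left)
    qed
    have grow: "A \<subseteq> R.evol A u" if "u < 1/2" for u
    proof
      fix y assume y: "y \<in> A"
      have "u * \<pi> y < \<pi> y / 2" using that pos[of y] by simp
      also have "\<dots> \<le> R.flow A y"
        using y flow_nonneg[of A y] reversed_nonneg[of y] by (simp add: ergodic_flow_lazy_reversal)
      finally show "y \<in> R.evol A u" by (simp add: evolving_set_def)
    qed
    have shrink: "R.evol A u \<subseteq> A" if "1/2 \<le> u" for u
    proof (rule ccontr)
      assume "\<not> R.evol A u \<subseteq> A"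
      then obtain y where y: "y \<in> R.evol A u" "y \<notin> A" by auto
      then have "u * \<pi> y < \<pi> y / 2"
        using flow_le[of A y] reversed_le[of y]
        by (simp add: evolving_set_def ergodic_flow_lazy_reversal)
      moreover have "1/2 * \<pi> y \<le> u * \<pi> y" using that pos[of y] by (intro mult_right_mono) auto
      ultimately show False by simp
    qed
    have jump: "sum \<pi> (R.evol A u) = a \<or> pi_min \<pi> \<le> \<bar>sum \<pi> (R.evol A u) - a\<bar>" for u
    proof -
      consider "R.evol A u = A" | "A \<subset> R.evol A u" | "R.evol A u \<subset> A"
        using grow[of u] shrink[of u] by (cases "u < 1/2") auto
      then show ?thesis
      proof cases
        case 2
        from pi_min_le_diff[OF this] show ?thesis unfolding a_def by (intro disjI2) linarith
      next
        case 3
        from pi_min_le_diff[OF this] show ?thesis unfolding a_def by (intro disjI2) linarith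
      qed (simp add: a_def)
    qed
    have int_plus: "(\<lambda>u. max 0 (sum \<pi> (R.evol A u) - a)) integrable_on {0..1}"
      by (rule evolving_set_integrable[where g = "\<lambda>S. max 0 (sum \<pi> S - a)"])
    have escaping: "(\<Sum>y\<in>R.evol A u. \<pi> y * (if y \<in> A then 0 else 1)) \<le> max 0 (sum \<pi> (R.evol A u) - a)" for u
    proof (cases "u < 1/2")
      case True
      have "sum \<pi> (R.evol A u) = sum \<pi> (R.evol A u - A) + a"
        unfolding a_def using grow[OF True] by (intro sum.subset_diff) auto
      moreover have "(\<Sum>y\<in>R.evol A u. \<pi> y * (if y \<in> A then 0 else 1)) = sum \<pi> (R.evol A u - A)"
        by (rule sum.mono_neutral_cong_right) auto
      ultimately show ?thesis by simp
    next
      case False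
      then have "(\<Sum>y\<in>R.evol A u. \<pi> y * (if y \<in> A then 0 else 1)) = 0"
        using shrink[of u] by (intro sum.neutral) auto
      then show ?thesis by simp
    qed
    have "Q_min P \<pi> \<le> ergodic_flow P \<pi> A (- A)" "Q_min P \<pi> \<le> ergodic_flow P \<pi> (- A) A"
      using Q_min_le[OF A(1) proper] Q_min_le[OF compl] A(1) by auto
    then have "Q_min P \<pi> / 2 \<le> (ergodic_flow P \<pi> A (- A) + ergodic_flow P \<pi> (- A) A) / 4" by simp
    also have "\<dots> = (\<Sum>y\<in>-A. (flow A y + (\<Sum>x\<in>A. \<pi> y * P y x)) / 4)"
      unfolding ergodic_flow_def
      by (subst sum.swap) (simp add: sum.distrib flip: sum_divide_distrib)
    also have "\<dots> = (\<Sum>y\<in>UNIV. R.flow A y * (if y \<in> A then 0 else 1))"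
      by (rule sum.mono_neutral_cong_left) (auto simp: ergodic_flow_lazy_reversal)
    also have "\<dots> = integral {0..1} (\<lambda>u. \<Sum>y\<in>R.evol A u. \<pi> y * (if y \<in> A then 0 else 1))"
      by (rule R.integral_sum_evol_unit[symmetric])
    also have "\<dots> \<le> integral {0..1} (\<lambda>u. max 0 (sum \<pi> (R.evol A u) - a))"
      by (intro integral_le int_plus escaping
          evolving_set_integrable[where g = "\<lambda>S. \<Sum>y\<in>S. \<pi> y * (if y \<in> A then 0 else 1)"])
    finally have spread: "Q_min P \<pi> / 2 \<le> integral {0..1} (\<lambda>u. max 0 (sum \<pi> (R.evol A u) - a))" .
    have "integral {0..1} (\<lambda>u. sin (pi * sum \<pi> (R.evol A u))) \<le>
        (1 - 2 * (Q_min P \<pi> / 2) / pi_min \<pi> * (1 - cos (pi * pi_min \<pi>))) * sin (pi * a)"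
    proof (rule integral_sin_spread_chord[where X = "\<lambda>u. sum \<pi> (R.evol A u)"])
      show "(\<lambda>u. sin (pi * sum \<pi> (R.evol A u))) integrable_on {0..1}"
        by (rule evolving_set_integrable[where g = "\<lambda>S. sin (pi * sum \<pi> S)"])
      show "(\<lambda>u. sum \<pi> (R.evol A u)) integrable_on {0..1}"
        by (rule evolving_set_integrable[where g = "sum \<pi>"])
      show "integral {0..1} (\<lambda>u. sum \<pi> (R.evol A u)) = a"
        unfolding a_def by (rule R.mass_evol_martingale)
      show "pi_min \<pi> \<le> a" unfolding a_def by (rule pi_min_le_mass[OF A(1)])
      show "pi_min \<pi> \<le> 1 - a" using pi_min_le_mass[OF compl] by (simp add: mass_compl a_def)
      show "0 \<le> sum \<pi> (R.evol A u) \<and> sum \<pi> (R.evol A u) \<le> 1" for u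
        by (simp add: mass_nonneg mass_le_1)
    qed (use jump int_plus spread pi_min_pos in simp_all)
    then show "integral {0..1} (\<lambda>u. sin (pi * sum \<pi> (R.evol A u))) \<le>
        (1 - Q_min P \<pi> / pi_min \<pi> * (1 - cos (pi * pi_min \<pi>))) * sin (pi * sum \<pi> A)"
      by (simp add: a_def)
  qed
qed

text \<open>
  The quadratic form of \<open>I/2 + (P + P\<^sup>*)/4\<close> is the average of those of \<open>I\<close> and \<open>P\<close>, so that the Dirichlet form of \<open>P\<close> is
  twice that of the lazy chain.
\<close>

lemma dirichlet_form_ge:
  assumes mean: "(\<Sum>x\<in>UNIV. \<pi> x * g x) = 0"
  shows "2 * Q_min P \<pi> / pi_min \<pi> * (1 - cos (pi * pi_min \<pi>)) * (\<Sum>x\<in>UNIV. \<pi> x * (g x)\<^sup>2)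
    \<le> 1/2 * (\<Sum>x\<in>UNIV. \<Sum>y\<in>UNIV. (g x - g y)\<^sup>2 * (\<pi> x * P x y))"
proof -
  interpret R: stationary_chain lazy_reversal \<pi> by (rule stationary_chain_lazy_reversal)
  define V where "V = (\<Sum>x\<in>UNIV. \<pi> x * (g x)\<^sup>2)"
  define D where "D = (\<Sum>x\<in>UNIV. \<Sum>y\<in>UNIV. (\<pi> x * P x y) * g x * g y)"
  have D': "(\<Sum>x\<in>UNIV. \<Sum>y\<in>UNIV. (\<pi> y * P y x) * g x * g y) = D"
    unfolding D_def by (subst sum.swap) (simp add: mult_ac)
  have diag: "(\<Sum>x\<in>UNIV. \<Sum>y\<in>UNIV. (if x = y then \<pi> y / 2 else 0) * g x * g y) = V / 2"
  proof -
    have "(if x = y then \<pi> y / 2 else 0) * g x * g y = (if x = y then \<pi> y * (g y)\<^sup>2 / 2 else 0)" for x y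
      by (simp add: power2_eq_square)
    then show ?thesis by (simp add: V_def sum_divide_distrib)
  qed
  have "(\<Sum>x\<in>UNIV. \<pi> x * g x * (\<Sum>y\<in>UNIV. lazy_reversal x y * g y)) =
      (\<Sum>x\<in>UNIV. \<Sum>y\<in>UNIV. (\<pi> x * lazy_reversal x y) * g x * g y)"
    by (simp add: sum_distrib_left mult_ac)
  also have "\<dots> = (\<Sum>x\<in>UNIV. \<Sum>y\<in>UNIV. (if x = y then \<pi> y / 2 else 0) * g x * g y)
      + ((\<Sum>x\<in>UNIV. \<Sum>y\<in>UNIV. (\<pi> x * P x y) * g x * g y)
        + (\<Sum>x\<in>UNIV. \<Sum>y\<in>UNIV. (\<pi> y * P y x) * g x * g y)) / 4"
    unfolding lazy_reversal_flow by (simp add: distrib_right sum.distrib add_divide_distrib sum_divide_distrib)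
  also have "\<dots> = (V + D) / 2" by (simp add: diag D' D_def[symmetric])
  finally have form: "(\<Sum>x\<in>UNIV. \<pi> x * g x * (\<Sum>y\<in>UNIV. lazy_reversal x y * g y)) = (V + D) / 2" .
  have contracted: "(V + D) / 2 \<le> (1 - Q_min P \<pi> / pi_min \<pi> * (1 - cos (pi * pi_min \<pi>))) * V"
    using R.reversible_form_le[OF lazy_reversal_reversible sine_contraction_lazy_reversal mean]
    unfolding form V_def[symmetric] .
  have dirichlet: "1/2 * (\<Sum>x\<in>UNIV. \<Sum>y\<in>UNIV. (g x - g y)\<^sup>2 * (\<pi> x * P x y)) = V - D"
    unfolding V_def D_def
    by (rule half_sum_squares) (simp_all add: balance P_sum flip: sum_distrib_left)
  have "2 * k * V \<le> V - D" if "(V + D) / 2 \<le> (1 - k) * V" for k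
    using that by (simp add: field_simps)
  from this[OF contracted] show ?thesis unfolding dirichlet by (simp add: V_def)
qed

lemma spectral_gap_ge:
  "2 * Q_min P \<pi> / pi_min \<pi> * (1 - cos (pi * pi_min \<pi>)) \<le> spectral_gap P \<pi>"
  unfolding spectral_gap_def
proof (rule cInf_greatest)
  have "\<exists>x y :: 'v. x \<noteq> y"
    using two_states card_le_Suc0_iff_eq[of "UNIV :: 'v set"] by auto
  then obtain x y :: 'v where xy: "x \<noteq> y" by blast
  \<comment> \<open>the indicator of a state has positive variance, so the infimum is over a nonempty set\<close>
  define f where "f z = (if z = x then 1 else 0 :: real)" for z
  have "expect \<pi> f = \<pi> x" by (simp add: expect_def f_def if_distrib cong: if_cong)
  moreover have "0 < \<pi> y * (f y - \<pi> x)\<^sup>2" using xy pos[of x] pos[of y] by (simp add: f_def)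
  moreover have "\<pi> y * (f y - \<pi> x)\<^sup>2 \<le> (\<Sum>z\<in>UNIV. \<pi> z * (f z - \<pi> x)\<^sup>2)"
    using pos by (intro member_le_sum mult_nonneg_nonneg) (auto intro: less_imp_le)
  ultimately have "var \<pi> f \<noteq> 0" by (simp add: var_def expect_def)
  then show "{(1 / 2 * (\<Sum>x\<in>UNIV. \<Sum>y\<in>UNIV. (f x - f y)\<^sup>2 * \<pi> x * P x y)) /
      (1 / 2 * (\<Sum>x\<in>UNIV. \<Sum>y\<in>UNIV. (f x - f y)\<^sup>2 * \<pi> x * \<pi> y)) | f. var \<pi> f \<noteq> 0} \<noteq> {}"
    by blast
next
  fix r assume "r \<in> {(1 / 2 * (\<Sum>x\<in>UNIV. \<Sum>y\<in>UNIV. (f x - f y)\<^sup>2 * \<pi> x * P x y)) /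
      (1 / 2 * (\<Sum>x\<in>UNIV. \<Sum>y\<in>UNIV. (f x - f y)\<^sup>2 * \<pi> x * \<pi> y)) | f. var \<pi> f \<noteq> 0}"
  then obtain f where f: "var \<pi> f \<noteq> 0" and
    r: "r = (1 / 2 * (\<Sum>x\<in>UNIV. \<Sum>y\<in>UNIV. (f x - f y)\<^sup>2 * \<pi> x * P x y)) /
      (1 / 2 * (\<Sum>x\<in>UNIV. \<Sum>y\<in>UNIV. (f x - f y)\<^sup>2 * \<pi> x * \<pi> y))" by blast
  define g where "g x = f x - expect \<pi> f" for x
  have mean: "(\<Sum>x\<in>UNIV. \<pi> x * g x) = 0"
    by (simp add: g_def right_diff_distrib sum_subtractf total expect_def flip: sum_distrib_right)
  have var: "var \<pi> f = (\<Sum>x\<in>UNIV. \<pi> x * (g x)\<^sup>2)" by (simp add: var_def expect_def g_def)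
  have "0 \<le> var \<pi> f" unfolding var using pos by (intro sum_nonneg mult_nonneg_nonneg) (auto intro: less_imp_le)
  then have var_pos: "0 < var \<pi> f" using f by simp
  have "(\<Sum>x\<in>UNIV. \<Sum>y\<in>UNIV. (\<pi> x * \<pi> y) * g x * g y) =
      (\<Sum>x\<in>UNIV. \<pi> x * g x) * (\<Sum>y\<in>UNIV. \<pi> y * g y)"
    by (simp add: sum_product mult_ac)
  then have "1/2 * (\<Sum>x\<in>UNIV. \<Sum>y\<in>UNIV. (g x - g y)\<^sup>2 * (\<pi> x * \<pi> y)) = var \<pi> f"
    using half_sum_squares[of "\<lambda>x y. \<pi> x * \<pi> y" g]
    by (simp add: mean var total flip: sum_distrib_left sum_distrib_right)
  then have "r = (1/2 * (\<Sum>x\<in>UNIV. \<Sum>y\<in>UNIV. (g x - g y)\<^sup>2 * (\<pi> x * P x y))) / var \<pi> f"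
    unfolding r by (simp add: g_def mult.assoc)
  then show "2 * Q_min P \<pi> / pi_min \<pi> * (1 - cos (pi * pi_min \<pi>)) \<le> r"
    using dirichlet_form_ge[OF mean] var_pos by (simp only: pos_le_divide_eq var)
qed

end

section \<open>The bounds\<close>

theorem theorem3p1:
  fixes P :: "'v::finite \<Rightarrow> 'v \<Rightarrow> real" and \<pi> :: "'v \<Rightarrow> real"
  assumes "CARD('v) \<ge> 2"
    and "markov_chain P"
    and "irreducible_chain P"
    and "stationary_distribution P \<pi>"
  shows "(\<forall>\<epsilon>>0. Psi_hat_min P \<pi> \<noteq> 0 \<longrightarrow>
            mixing_time_le P \<pi> \<epsilon>
              (inverse_neg_ln (1 - 2 * (A_hat_min P \<pi> / Delta_min \<pi>) * (1 - cos (2 * pi * A_hat_max P \<pi>)))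
                 * ln ((1 - pi_min \<pi>) / \<epsilon>)))
       \<and> (\<forall>l. chain_eigenvalue P l \<and> l \<noteq> 1 \<longrightarrow>
            1 - cmod l \<ge> 2 * (A_hat_min P \<pi> / Delta_min \<pi>) * (1 - cos (2 * pi * A_hat_max P \<pi>)))
       \<and> spectral_gap P \<pi> \<ge> 2 * Q_min P \<pi> / pi_min \<pi> * (1 - cos (pi * pi_min \<pi>))"
proof -
  interpret stationary_chain P \<pi>
    using assms irreducible_stationary_pos[OF assms(2-4)] by unfold_locales auto
  show ?thesis
  proof (intro conjI allI impI)
    fix \<epsilon> :: real assume "0 < \<epsilon>" "Psi_hat_min P \<pi> \<noteq> 0"
    then show "mixing_time_le P \<pi> \<epsilon>
        (inverse_neg_ln (1 - 2 * (A_hat_min P \<pi> / Delta_min \<pi>) * (1 - cos (2 * pi * A_hat_max P \<pi>)))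
           * ln ((1 - pi_min \<pi>) / \<epsilon>))"
      by (intro mixing_time_bound sine_contraction_Psi_hat contraction_factor_less_1)
  next
    fix l assume "chain_eigenvalue P l \<and> l \<noteq> 1"
    then show "2 * (A_hat_min P \<pi> / Delta_min \<pi>) * (1 - cos (2 * pi * A_hat_max P \<pi>)) \<le> 1 - cmod l"
      using eigenvalue_le_contraction[OF sine_contraction_Psi_hat, of l] by simp
  qed (rule spectral_gap_ge)
qed

end
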